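(* Consider the constrained online convex optimization problem described in the context, and suppose that the boundedness/smoothness assumptions, Slater's condition with constant $\varsigma>0$, and the bounded-divergence assumption $D(\mathbf x,\mathbf y)\le R^2$ for all $\mathbf x,\mathbf y\in\mathcal X_0$ hold. Set $$\eta=[V_*(T)+L_f^2+1]^{-1/2},\qquad \gamma=[V_*(T)+L_f^2+1]^{1/4},$$ $$\alpha_t=\max\big\{2\rho^{-1}\big(\gamma^2L_gG+\eta L_f^2+\eta^{-1}+\xi_t\big),\ \alpha_{t-1}\big\}\quad\text{with }\alpha_0=0,$$ where $\xi_t:=\gamma L_g\|\mathbf Q(t)\|_1+\gamma^2(L_gG+H^2)$. Then the online primal-dual mirror-prox algorithm described in the context ensures the following regret: $$\mathrm{Regret}(T)\le \mathcal O\Big((1+\varsigma^{-1})\sqrt{V_*(T)+L_f^2+1}+\varsigma^{-1}\Big)=\mathcal O\big(\sqrt{V_*(T)}\vee L_f\big),$$ where $\mathcal O$ hides constants $\mathrm{poly}(R,H,F,G,L_g,K,\rho)$.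
   Context: Notation. $\|\cdot\|$ is a norm on $\mathbb R^d$ with dual norm $\|\mathbf x\|_*=\sup_{\|\mathbf y\|\le1}\langle\mathbf x,\mathbf y\rangle$; $[K]=\{1,\dots,K\}$; $a\vee b=\max\{a,b\}$; $\mathrm{poly}(\cdots)$ denotes a polynomial term composed of the variables inside the parentheses. Problem. $\mathcal X_0\subset\mathbb R^d$ is a convex compact set. The losses $f^t:\mathcal X_0\to\mathbb R$ are convex and differentiable; $f^t$ is observed after the decision $\mathbf x_t$ is generated. The constraint functions $g_k$, $k\in[K]$, are convex and differentiable; $\mathbf g(\mathbf x)=[g_1(\mathbf x),\dots,g_K(\mathbf x)]^\top$; $\mathcal X=\{\mathbf x\in\mathcal X_0: g_k(\mathbf x)\le0,\ \forall k\in[K]\}$. Over $T$ rounds, $$\mathrm{Regret}(T)=\sum_{t=1}^Tf^t(\mathbf x_t)-\sum_{t=1}^Tf^t(\mathbf x^* ),\quad \mathbf x^*\in\arg\min_{\mathbf x\in\mathcal X}\sum_{t=1}^Tf^t(\mathbf x),$$ $$V_*(T)=\sum_{t=1}^T\max_{\mathbf x\in\mathcal X_0}\|\nabla f^t(\mathbf x)-\nabla f^{t-1}(\mathbf x)\|_*^2.$$ Boundedness/smoothness assumptions. For all $\mathbf x,\mathbf y\in\mathcal X_0$, $t\ge0$, $k\in[K]$: $\|\nabla f^t(\mathbf x)\|_*\le F$; $\|\nabla f^t(\mathbf x)-\nabla f^t(\mathbf y)\|_*\le L_f\|\mathbf x-\mathbf y\|$; $\sum_{k=1}^K|g_k(\mathbf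 x)|\le G$; $|g_k(\mathbf x)-g_k(\mathbf y)|\le H_k\|\mathbf x-\mathbf y\|$, with $H:=\sum_{k=1}^KH_k$; $\|\nabla g_k(\mathbf x)-\nabla g_k(\mathbf y)\|_*\le L_g\|\mathbf x-\mathbf y\|$. Slater's condition. There exist a constant $\varsigma>0$ and a point $\breve{\mathbf x}\in\mathcal X_0$ such that $g_k(\breve{\mathbf x})\le-\varsigma$ for all $k\in[K]$. Bregman divergence. $\omega:\mathcal X_0\to\mathbb R$ is strictly convex, continuously differentiable in the interior of $\mathcal X_0$, and is a distance generating function with modulus $\rho$ w.r.t. $\|\cdot\|$, that is, $\rho$-strongly convex: $\langle\mathbf x-\mathbf y,\nabla\omega(\mathbf x)-\nabla\omega(\mathbf y)\rangle\ge\rho\|\mathbf x-\mathbf y\|^2$. For $\mathbf x,\mathbf y\in\mathcal X_0$, $D(\mathbf x,\mathbf y)=\omega(\mathbf x)-\omega(\mathbf y)-\langle\nabla\omega(\mathbf y),\mathbf x-\mathbf y\rangle$; it satisfies $D(\mathbf x,\mathbf y)\ge\frac\rho2\|\mathbf x-\mathbf y\|^2$. Bounded-divergence assumption. There exists $R>0$ such that $D(\mathbf x,\mathbf y)\le R^2$ for all $\mathbf x,\mathbf y\in\mathcal X_0$. Online primal-dual mirror-prox algorithm (parameters $\gamma>0$, $\alpha_t$). Initialize $\mathbf x_0,\mathbf x_1,\tilde{\mathbf x}_1\in\mathcal X_0$ and $Q_k(0)=0$, $k\in[K]$. For $t=1,\dots,T$: (1) update the dual iterate $Q_k(t)=\max\{-\gamma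 g_k(\mathbf x_{t-1}),\ Q_k(t-1)+\gamma g_k(\mathbf x_{t-1})\}$ for $k\in[K]$, and write $\mathbf Q(t)=[Q_1(t),\dots,Q_K(t)]^\top$; (2) update the primal iterate $\mathbf x_t=\arg\min_{\mathbf x\in\mathcal X_0}\langle\nabla f^{t-1}(\mathbf x_{t-1}),\mathbf x\rangle+\sum_{k=1}^K[Q_k(t)+\gamma g_k(\mathbf x_{t-1})]\langle\gamma\nabla g_k(\mathbf x_{t-1}),\mathbf x\rangle+\alpha_tD(\mathbf x,\tilde{\mathbf x}_t)$; (3) play $\mathbf x_t$, suffer loss $f^t(\mathbf x_t)$ and compute $\nabla f^t(\mathbf x_t)$; (4) update the intermediate iterate $\tilde{\mathbf x}_{t+1}=\arg\min_{\mathbf x\in\mathcal X_0}\langle\nabla f^t(\mathbf x_t),\mathbf x\rangle+\sum_{k=1}^K[Q_k(t)+\gamma g_k(\mathbf x_{t-1})]\langle\gamma\nabla g_k(\mathbf x_{t-1}),\mathbf x\rangle+\alpha_tD(\mathbf x,\tilde{\mathbf x}_t)$.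
   Formalization: The hidden constants may also depend polynomially on 1/ρ; the second bound O(√V_*(T) ∨ L_f) is stated for max{√V_*(T), L_f} ≥ c with any fixed c>0, its constant depending on c and polynomially also on 1/ς. *)

theory Defs
  imports "HOL-Analysis.Analysis"
begin

text \<open>
  The constants hidden by \<open>\<O>\<close> in the regret bound are independent of the dimension \<open>d\<close>, so \<open>d\<close> has
  to be quantified \<^emph>\<open>inside\<close> the existential quantifier for these constants and cannot be a type
  variable as in \<open>real ^ 'd\<close>.  We therefore work in the inner product space \<open>rvec\<close> of finitely
  supported real sequences, in which \<open>\<real>\<^sup>d\<close> is the subspace \<open>Rd d\<close> of the sequences that vanish from
  index \<open>d\<close> on, with the usual coordinatewise operations and inner product.
\<close>

typedef rvec = "{x :: nat \<Rightarrow> real. finite {i. x i \<noteq> 0}}"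
  morphisms coord Abs_rvec
  by (rule exI[of _ "\<lambda>_. 0"]) simp

lemma finite_coord: "finite {i. coord x i \<noteq> 0}"
  using coord[of x] by simp

lemma rvec_eqI: "(\<And>i. coord x i = coord y i) \<Longrightarrow> x = y"
  by (simp add: coord_inject[symmetric] fun_eq_iff)

instantiation rvec :: real_vector
begin

definition "0 = Abs_rvec (\<lambda>_. 0)"
definition "x + y = Abs_rvec (\<lambda>i. coord x i + coord y i)"
definition "- x = Abs_rvec (\<lambda>i. - coord x i)"
definition "x - y = Abs_rvec (\<lambda>i. coord x i - coord y i)"
definition "r *\<^sub>R x = Abs_rvec (\<lambda>i. r * coord x i)"

lemma coord_zero [simp]: "coord 0 i = 0"
  by (simp add: zero_rvec_def Abs_rvec_inverse)

lemma coord_add [simp]: "coord (x + y) i = coord x i + coord y i"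
proof -
  have "finite {i. coord x i + coord y i \<noteq> 0}"
    by (rule finite_subset[OF _ finite_UnI[OF finite_coord[of x] finite_coord[of y]]]) auto
  then show ?thesis by (simp add: plus_rvec_def Abs_rvec_inverse)
qed

lemma coord_uminus [simp]: "coord (- x) i = - coord x i"
  using finite_coord[of x] by (simp add: uminus_rvec_def Abs_rvec_inverse)

lemma coord_diff [simp]: "coord (x - y) i = coord x i - coord y i"
proof -
  have "finite {i. coord x i - coord y i \<noteq> 0}"
    by (rule finite_subset[OF _ finite_UnI[OF finite_coord[of x] finite_coord[of y]]]) auto
  then show ?thesis by (simp add: minus_rvec_def Abs_rvec_inverse)
qed

lemma coord_scaleR [simp]: "coord (r *\<^sub>R x) i = r * coord x i"
proof -
  have "finite {i. r * coord x i \<noteq> 0}"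
    by (rule finite_subset[OF _ finite_coord[of x]]) auto
  then show ?thesis by (simp add: scaleR_rvec_def Abs_rvec_inverse)
qed

instance
  by standard (auto intro!: rvec_eqI simp: algebra_simps)

end

instantiation rvec :: real_inner
begin

definition "inner x y = (\<Sum>i | coord x i \<noteq> 0. coord x i * coord y i)"
definition "norm (x :: rvec) = sqrt (inner x x)"
definition "sgn (x :: rvec) = x /\<^sub>R norm x"
definition "dist (x :: rvec) y = norm (x - y)"
definition [code del]:
  "(uniformity :: (rvec \<times> rvec) filter) = (INF e\<in>{0<..}. principal {(x, y). dist x y < e})"
definition [code del]:
  "open (U :: rvec set) \<longleftrightarrow> (\<forall>x\<in>U. eventually (\<lambda>(x', y). x' = x \<longrightarrow> y \<in> U) uniformity)"

lemma inner_rvec_eq: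
  assumes "finite A" "{i. coord x i \<noteq> 0} \<subseteq> A"
  shows "inner x y = (\<Sum>i\<in>A. coord x i * coord y i)"
  unfolding inner_rvec_def by (rule sum.mono_neutral_left) (use assms in auto)

instance
proof
  fix x y z :: rvec and r :: real
  let ?A = "{i. coord x i \<noteq> 0} \<union> {i. coord y i \<noteq> 0}"
  have A: "finite ?A" by (simp add: finite_coord)
  have "inner x y = (\<Sum>i\<in>?A. coord x i * coord y i)" by (rule inner_rvec_eq[OF A]) auto
  moreover have "inner y x = (\<Sum>i\<in>?A. coord y i * coord x i)" by (rule inner_rvec_eq[OF A]) auto
  ultimately show "inner x y = inner y x" by (simp add: mult.commute)
  have "inner (x + y) z = (\<Sum>i\<in>?A. coord (x + y) i * coord z i)" by (rule inner_rvec_eq[OF A]) auto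
  moreover have "inner x z = (\<Sum>i\<in>?A. coord x i * coord z i)" by (rule inner_rvec_eq[OF A]) auto
  moreover have "inner y z = (\<Sum>i\<in>?A. coord y i * coord z i)" by (rule inner_rvec_eq[OF A]) auto
  ultimately show "inner (x + y) z = inner x z + inner y z"
    by (simp add: sum.distrib[symmetric] algebra_simps)
  have "inner (r *\<^sub>R x) y = (\<Sum>i\<in>?A. coord (r *\<^sub>R x) i * coord y i)" by (rule inner_rvec_eq[OF A]) auto
  then show "inner (r *\<^sub>R x) y = r * inner x y"
    using \<open>inner x y = (\<Sum>i\<in>?A. coord x i * coord y i)\<close> by (simp add: sum_distrib_left mult.assoc)
  show "0 \<le> inner x x" by (auto simp: inner_rvec_def intro!: sum_nonneg)
  have "inner x x = 0 \<longleftrightarrow> (\<forall>i\<in>{i. coord x i \<noteq> 0}. coord x i * coord x i = 0)"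
    unfolding inner_rvec_def by (rule sum_nonneg_eq_0_iff) (auto simp: finite_coord)
  then show "inner x x = 0 \<longleftrightarrow> x = 0" by (auto intro: rvec_eqI)
qed (simp_all add: norm_rvec_def sgn_rvec_def dist_rvec_def uniformity_rvec_def open_rvec_def)

end

definition Rd :: "nat \<Rightarrow> rvec set" where
  "Rd d = {x. \<forall>i\<ge>d. coord x i = 0}"

text \<open>\<open>N\<close> is an arbitrary norm on \<open>\<real>\<^sup>d\<close>; the type-class norm of \<open>rvec\<close> is the Euclidean one.\<close>

definition is_norm :: "nat \<Rightarrow> (rvec \<Rightarrow> real) \<Rightarrow> bool" where
  "is_norm d N \<longleftrightarrow>
     (\<forall>x\<in>Rd d. 0 \<le> N x \<and> (N x = 0 \<longleftrightarrow> x = 0)) \<and>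
     (\<forall>x\<in>Rd d. \<forall>a. N (a *\<^sub>R x) = \<bar>a\<bar> * N x) \<and>
     (\<forall>x\<in>Rd d. \<forall>y\<in>Rd d. N (x + y) \<le> N x + N y)"

definition dual_norm :: "nat \<Rightarrow> (rvec \<Rightarrow> real) \<Rightarrow> rvec \<Rightarrow> real" where
  "dual_norm d N x = (SUP y\<in>{y \<in> Rd d. N y \<le> 1}. x \<bullet> y)"

text \<open>
  \<open>\<phi>\<close> is differentiable on \<open>S \<subseteq> \<real>\<^sup>d\<close> with gradient map \<open>D\<phi>\<close>.  The functions of the problem are only
  given on \<open>S\<close>, so the derivative is taken within \<open>S\<close>; at interior points of \<open>S\<close> (relative to \<open>\<real>\<^sup>d\<close>)
  this is the ordinary gradient.
\<close>

definition gradient_on :: "nat \<Rightarrow> rvec set \<Rightarrow> (rvec \<Rightarrow> real) \<Rightarrow> (rvec \<Rightarrow> rvec) \<Rightarrow> bool" where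
  "gradient_on d S \<phi> D\<phi> \<longleftrightarrow>
     (\<forall>x\<in>S. D\<phi> x \<in> Rd d \<and> (\<phi> has_derivative (\<lambda>h. D\<phi> x \<bullet> h)) (at x within S))"

locale constrained_oco =
  fixes d :: nat and N :: "rvec \<Rightarrow> real" and X0 :: "rvec set"
    and f :: "nat \<Rightarrow> rvec \<Rightarrow> real" and df :: "nat \<Rightarrow> rvec \<Rightarrow> rvec"
    and K :: nat and g :: "nat \<Rightarrow> rvec \<Rightarrow> real" and dg :: "nat \<Rightarrow> rvec \<Rightarrow> rvec"
    and F L\<^sub>f G :: real and Hk :: "nat \<Rightarrow> real" and L\<^sub>g :: real
  assumes dim_pos: "1 \<le> d"
    and norm_N: "is_norm d N"
    and X0_sub: "X0 \<subseteq> Rd d"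
    and X0_convex: "convex X0"
    and X0_compact: "compact X0"
    and f_convex: "\<And>t. convex_on X0 (f t)"
    and f_gradient: "\<And>t. gradient_on d X0 (f t) (df t)"
    and K_pos: "1 \<le> K"
    and g_convex: "\<And>k. k \<in> {1..K} \<Longrightarrow> convex_on X0 (g k)"
    and g_gradient: "\<And>k. k \<in> {1..K} \<Longrightarrow> gradient_on d X0 (g k) (dg k)"
    and df_bound: "\<And>t x. x \<in> X0 \<Longrightarrow> dual_norm d N (df t x) \<le> F"
    and Lf_nonneg: "0 \<le> L\<^sub>f"
    and df_lipschitz: "\<And>t x y. x \<in> X0 \<Longrightarrow> y \<in> X0 \<Longrightarrow>
          dual_norm d N (df t x - df t y) \<le> L\<^sub>f * N (x - y)"
    and g_bound: "\<And>x. x \<in> X0 \<Longrightarrow> (\<Sum>k=1..K. \<bar>g k x\<bar>) \<le> G"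
    and Hk_nonneg: "\<And>k. k \<in> {1..K} \<Longrightarrow> 0 \<le> Hk k"
    and g_lipschitz: "\<And>k x y. k \<in> {1..K} \<Longrightarrow> x \<in> X0 \<Longrightarrow> y \<in> X0 \<Longrightarrow>
          \<bar>g k x - g k y\<bar> \<le> Hk k * N (x - y)"
    and Lg_nonneg: "0 \<le> L\<^sub>g"
    and dg_lipschitz: "\<And>k x y. k \<in> {1..K} \<Longrightarrow> x \<in> X0 \<Longrightarrow> y \<in> X0 \<Longrightarrow>
          dual_norm d N (dg k x - dg k y) \<le> L\<^sub>g * N (x - y)"

definition slater :: "rvec set \<Rightarrow> nat \<Rightarrow> (nat \<Rightarrow> rvec \<Rightarrow> real) \<Rightarrow> real \<Rightarrow> bool" where
  "slater X0 K g \<sigma> \<longleftrightarrow> 0 < \<sigma> \<and> (\<exists>x\<in>X0. \<forall>k\<in>{1..K}. g k x \<le> - \<sigma>)"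

definition feasible_set :: "rvec set \<Rightarrow> nat \<Rightarrow> (nat \<Rightarrow> rvec \<Rightarrow> real) \<Rightarrow> rvec set" where
  "feasible_set X0 K g = {x \<in> X0. \<forall>k\<in>{1..K}. g k x \<le> 0}"

definition regret :: "(nat \<Rightarrow> rvec \<Rightarrow> real) \<Rightarrow> (nat \<Rightarrow> rvec) \<Rightarrow> rvec \<Rightarrow> nat \<Rightarrow> real" where
  "regret f x xs T = (\<Sum>t=1..T. f t (x t)) - (\<Sum>t=1..T. f t xs)"

text \<open>
  Under \<^locale>\<open>constrained_oco\<close> the supremum is a maximum: \<open>X0\<close> is compact and the gradients are
  Lipschitz continuous.
\<close>

definition grad_variation ::
  "nat \<Rightarrow> (rvec \<Rightarrow> real) \<Rightarrow> rvec set \<Rightarrow> (nat \<Rightarrow> rvec \<Rightarrow> rvec) \<Rightarrow> nat \<Rightarrow> real" where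
  "grad_variation d N X0 df T = (\<Sum>t=1..T. SUP x\<in>X0. (dual_norm d N (df t x - df (t - 1) x))\<^sup>2)"

definition bregman :: "(rvec \<Rightarrow> real) \<Rightarrow> (rvec \<Rightarrow> rvec) \<Rightarrow> rvec \<Rightarrow> rvec \<Rightarrow> real" where
  "bregman \<omega> d\<omega> x y = \<omega> x - \<omega> y - d\<omega> y \<bullet> (x - y)"

text \<open>
  The Bregman divergence \<open>D(x,y)\<close> is used for all \<open>x, y \<in> X0\<close>, so \<open>\<omega>\<close> needs a gradient at every point
  of \<open>X0\<close>; continuity of the gradient is required only in the interior.
\<close>

locale distance_generating =
  fixes d :: nat and N :: "rvec \<Rightarrow> real" and X0 :: "rvec set"
    and \<omega> :: "rvec \<Rightarrow> real" and d\<omega> :: "rvec \<Rightarrow> rvec" and \<rho> :: real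
  assumes \<omega>_strictly_convex: "\<And>x y u. x \<in> X0 \<Longrightarrow> y \<in> X0 \<Longrightarrow> x \<noteq> y \<Longrightarrow> 0 < u \<Longrightarrow> u < 1 \<Longrightarrow>
          \<omega> ((1 - u) *\<^sub>R x + u *\<^sub>R y) < (1 - u) * \<omega> x + u * \<omega> y"
    and \<omega>_gradient: "gradient_on d X0 \<omega> d\<omega>"
    and d\<omega>_continuous: "continuous_on (top_of_set (Rd d) interior_of X0) d\<omega>"
    and \<rho>_pos: "0 < \<rho>"
    and strongly_convex: "\<And>x y. x \<in> X0 \<Longrightarrow> y \<in> X0 \<Longrightarrow>
          (x - y) \<bullet> (d\<omega> x - d\<omega> y) \<ge> \<rho> * (N (x - y))\<^sup>2"

text \<open>
  Objective, as a function of \<open>u\<close>, of the two primal minimisations of the algorithm: \<open>v\<close> is the loss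
  gradient in use, \<open>q\<close> the dual iterate, \<open>y\<close> the previous decision, \<open>a\<close> the step parameter and \<open>z\<close>
  the prox centre.
\<close>

definition prox_objective ::
  "(rvec \<Rightarrow> real) \<Rightarrow> (rvec \<Rightarrow> rvec) \<Rightarrow> nat \<Rightarrow> (nat \<Rightarrow> rvec \<Rightarrow> real) \<Rightarrow> (nat \<Rightarrow> rvec \<Rightarrow> rvec) \<Rightarrow> real \<Rightarrow>
   rvec \<Rightarrow> (nat \<Rightarrow> real) \<Rightarrow> rvec \<Rightarrow> real \<Rightarrow> rvec \<Rightarrow> rvec \<Rightarrow> real" where
  "prox_objective \<omega> d\<omega> K g dg \<gamma> v q y a z u =
     v \<bullet> u + (\<Sum>k=1..K. (q k + \<gamma> * g k y) * ((\<gamma> *\<^sub>R dg k y) \<bullet> u)) + a * bregman \<omega> d\<omega> u z"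

text \<open>
  \<open>Q t k\<close> is the \<open>k\<close>-th dual variable and \<open>xt t\<close> the intermediate iterate of round \<open>t\<close>.  The decision
  \<open>x 1\<close> is the one computed in round 1.
\<close>

definition mirror_prox_run ::
  "rvec set \<Rightarrow> (nat \<Rightarrow> rvec \<Rightarrow> rvec) \<Rightarrow> nat \<Rightarrow> (nat \<Rightarrow> rvec \<Rightarrow> real) \<Rightarrow> (nat \<Rightarrow> rvec \<Rightarrow> rvec) \<Rightarrow>
   (rvec \<Rightarrow> real) \<Rightarrow> (rvec \<Rightarrow> rvec) \<Rightarrow> real \<Rightarrow> (nat \<Rightarrow> real) \<Rightarrow> nat \<Rightarrow>
   (nat \<Rightarrow> rvec) \<Rightarrow> (nat \<Rightarrow> rvec) \<Rightarrow> (nat \<Rightarrow> nat \<Rightarrow> real) \<Rightarrow> bool" where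
  "mirror_prox_run X0 df K g dg \<omega> d\<omega> \<gamma> \<alpha> T x xt Q \<longleftrightarrow>
     x 0 \<in> X0 \<and> xt 1 \<in> X0 \<and> (\<forall>k\<in>{1..K}. Q 0 k = 0) \<and>
     (\<forall>t\<in>{1..T}.
        (\<forall>k\<in>{1..K}. Q t k =
           max (- \<gamma> * g k (x (t - 1))) (Q (t - 1) k + \<gamma> * g k (x (t - 1)))) \<and>
        is_arg_min
          (prox_objective \<omega> d\<omega> K g dg \<gamma> (df (t - 1) (x (t - 1))) (Q t) (x (t - 1)) (\<alpha> t) (xt t))
          (\<lambda>u. u \<in> X0) (x t) \<and>
        is_arg_min
          (prox_objective \<omega> d\<omega> K g dg \<gamma> (df t (x t)) (Q t) (x (t - 1)) (\<alpha> t) (xt t))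
          (\<lambda>u. u \<in> X0) (xt (t + 1)))"

definition dual_l1 :: "nat \<Rightarrow> (nat \<Rightarrow> real) \<Rightarrow> real" where
  "dual_l1 K q = (\<Sum>k=1..K. \<bar>q k\<bar>)"

end

theory Submission
  imports Defs
begin

text \<open>
  The inequality behind the theorem is proved for a single round (\<open>one_round\<close>).  The two minimisations
  of a round share their constraint term and their prox centre.  Their optimality conditions therefore
  combine so that the loss at \<open>x\<^sub>t\<close> is compared with that of an arbitrary \<open>u \<in> X0\<close> at the cost of
  \<open>(\<nabla>f\<^sup>t(x\<^sub>t) - \<nabla>f\<^sup>t\<^sup>-\<^sup>1(x\<^sub>t\<^sub>-\<^sub>1)) \<bullet> (x\<^sub>t - z)\<close>, where \<open>z\<close> is the next prox centre, and of a difference of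
  divergences; only the \<^emph>\<open>change\<close> of the loss gradient is paid for, and this is what brings in \<open>V\<close>.
  The constraint term supplies the increment of \<open>\<parallel>Q\<parallel>\<^sup>2 / 2\<close>, since the dual step is a gradient step on the
  constraints; the errors are squares of movements of the iterates.  The step parameters \<open>\<alpha>\<^sub>t\<close> are
  so large that the strong convexity of \<open>\<omega>\<close> absorbs these squares.

  Summing (\<open>window_bound\<close>) leaves \<open>\<eta> V + \<gamma>\<^sup>2 G\<^sup>2 + \<alpha> R\<^sup>2\<close>, a starting term, and the value of the
  constraints at \<open>u\<close> weighted by the multipliers \<open>Q\<^sub>k(t) + \<gamma> g\<^sub>k(x\<^sub>t\<^sub>-\<^sub>1) \<ge> 0\<close>.  With \<open>w = sqrt (V + L\<^sub>f\<^sup>2 + 1)\<close>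
  the tuning is \<open>\<gamma>\<^sup>2 = w\<close>, \<open>\<eta> = 1 / w\<close>, so all of this is of order \<open>w\<close>, except that \<open>\<alpha>\<close> and the
  starting term contain \<open>\<gamma> L\<^sub>g \<parallel>Q\<parallel>\<^sub>1\<close>.

  The dual iterates are controlled by the same inequality with \<open>u\<close> the Slater point
  (\<open>dual_iterate_bound\<close>): then the weighted constraint values are at most \<open>- \<sigma>\<close> times the sum of the
  multipliers, and over a window of about \<open>const / \<sigma>\<close> rounds this pull exceeds the effect of
  \<open>\<parallel>Q\<parallel>\<^sub>1\<close> on the other terms.  Hence
  \<open>\<gamma> \<parallel>Q(t)\<parallel>\<^sub>1 = O((1 + 1 / \<sigma>) w)\<close>.  With \<open>u\<close> the best feasible point the weighted constraint values are
  nonpositive, and the regret is \<open>O((1 + 1 / \<sigma>) w)\<close> (\<open>regret_bound\<close>).  The second bound of the theorem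
  follows because \<open>w\<close> is at most a multiple of \<open>max (sqrt V) L\<^sub>f\<close> once the latter is bounded away from \<open>0\<close>.
\<close>

section \<open>Norms on \<open>\<real>\<^sup>d\<close> and their duals\<close>

lemma Rd_zero [simp]: "0 \<in> Rd d"
  and Rd_add: "x \<in> Rd d \<Longrightarrow> y \<in> Rd d \<Longrightarrow> x + y \<in> Rd d"
  and Rd_diff: "x \<in> Rd d \<Longrightarrow> y \<in> Rd d \<Longrightarrow> x - y \<in> Rd d"
  and Rd_scaleR: "x \<in> Rd d \<Longrightarrow> a *\<^sub>R x \<in> Rd d"
  by (auto simp: Rd_def)

lemma Rd_sum: "(\<And>i. i \<in> I \<Longrightarrow> x i \<in> Rd d) \<Longrightarrow> sum x I \<in> Rd d"
  by (induction I rule: infinite_finite_induct) (auto intro: Rd_add)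

lemma coord_sum: "coord (sum x I) j = (\<Sum>i\<in>I. coord (x i) j)"
  by (induction I rule: infinite_finite_induct) auto

definition unit_rvec :: "nat \<Rightarrow> rvec" where
  "unit_rvec i = Abs_rvec (\<lambda>j. if j = i then 1 else 0)"

lemma coord_unit_rvec [simp]: "coord (unit_rvec i) j = (if j = i then 1 else 0)"
  by (simp add: unit_rvec_def Abs_rvec_inverse)

lemma unit_rvec_in_Rd: "i < d \<Longrightarrow> unit_rvec i \<in> Rd d"
  by (auto simp: Rd_def)

lemma Rd_unit_expansion:
  assumes "x \<in> Rd d"
  shows "x = (\<Sum>i<d. coord x i *\<^sub>R unit_rvec i)"
proof (rule rvec_eqI)
  fix j
  show "coord x j = coord (\<Sum>i<d. coord x i *\<^sub>R unit_rvec i) j"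
    using assms by (auto simp: coord_sum Rd_def if_distrib sum.delta cong: if_cong)
qed

lemma
  assumes "is_norm d N" "x \<in> Rd d"
  shows is_norm_nonneg: "0 \<le> N x"
    and is_norm_eq_0: "N x = 0 \<longleftrightarrow> x = 0"
    and is_norm_scaleR: "N (a *\<^sub>R x) = \<bar>a\<bar> * N x"
    and is_norm_triangle: "y \<in> Rd d \<Longrightarrow> N (x + y) \<le> N x + N y"
  using assms by (auto simp: is_norm_def)

lemma is_norm_minus_commute:
  assumes "is_norm d N" "x \<in> Rd d" "y \<in> Rd d"
  shows "N (x - y) = N (y - x)"
proof -
  have "N (x - y) = N ((-1) *\<^sub>R (y - x))"
    by simp
  also have "\<dots> = N (y - x)"
    by (subst is_norm_scaleR[OF assms(1)]) (auto intro: Rd_diff assms)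
  finally show ?thesis .
qed

lemma is_norm_sum:
  assumes "is_norm d N" "\<And>i. i \<in> I \<Longrightarrow> x i \<in> Rd d"
  shows "N (sum x I) \<le> (\<Sum>i\<in>I. N (x i))"
  using assms(2)
proof (induction I rule: infinite_finite_induct)
  case (insert i I)
  then show ?case
    using is_norm_triangle[OF assms(1), of "x i" "sum x I"] by (force intro: Rd_sum)
qed (use is_norm_eq_0[OF assms(1), of 0] in auto)

lemma is_norm_coord_bound:
  assumes "is_norm d N" "x \<in> Rd d"
  shows "N x \<le> (\<Sum>i<d. \<bar>coord x i\<bar> * N (unit_rvec i))"
proof -
  have "N x = N (\<Sum>i<d. coord x i *\<^sub>R unit_rvec i)"
    using Rd_unit_expansion[OF assms(2)] by simp
  also have "\<dots> \<le> (\<Sum>i<d. N (coord x i *\<^sub>R unit_rvec i))"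
    by (rule is_norm_sum[OF assms(1)]) (auto intro: Rd_scaleR unit_rvec_in_Rd)
  also have "\<dots> = (\<Sum>i<d. \<bar>coord x i\<bar> * N (unit_rvec i))"
    by (intro sum.cong refl is_norm_scaleR[OF assms(1)]) (auto intro: unit_rvec_in_Rd)
  finally show ?thesis .
qed

text \<open>
  Half of the equivalence of norms on \<open>\<real>\<^sup>d\<close>.  It makes the supremum that defines the dual norm
  finite; without it \<open>SUP\<close> would be an unspecified real number.  If the bound failed for every
  constant, vectors of \<open>l1\<close>-norm one with \<open>N\<close> tending to \<open>0\<close> would have a coordinatewise limit, again of
  \<open>l1\<close>-norm one, at which \<open>N\<close> vanishes.
\<close>

lemma coord_sum_le_norm:
  assumes N: "is_norm d N"
  obtains C where "\<And>x. x \<in> Rd d \<Longrightarrow> (\<Sum>i<d. \<bar>coord x i\<bar>) \<le> C * N x"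
proof (rule ccontr)
  assume "\<not> thesis"
  then have "\<exists>x\<in>Rd d. real n * N x < (\<Sum>i<d. \<bar>coord x i\<bar>)" for n
    using that[of "real n"] by fastforce
  then obtain X where X: "\<And>n. X n \<in> Rd d" "\<And>n. real n * N (X n) < (\<Sum>i<d. \<bar>coord (X n) i\<bar>)"
    by metis
  define l where "l n = (\<Sum>i<d. \<bar>coord (X n) i\<bar>)" for n
  have l: "0 < l n" for n
    using X(2)[of n] is_norm_nonneg[OF N X(1), of n] mult_nonneg_nonneg[OF of_nat_0_le_iff, of "N (X n)" n]
    unfolding l_def by linarith
  define Y where "Y n = inverse (l n) *\<^sub>R X n" for n
  have Y: "Y n \<in> Rd d" for n
    by (simp add: Y_def Rd_scaleR X)
  have Y1: "(\<Sum>i<d. \<bar>coord (Y n) i\<bar>) = 1" for n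
  proof -
    have "(\<Sum>i<d. \<bar>coord (Y n) i\<bar>) = inverse (l n) * (\<Sum>i<d. \<bar>coord (X n) i\<bar>)"
      using l[of n] by (simp add: Y_def abs_mult sum_distrib_left)
    then show ?thesis
      using l[of n] unfolding l_def[symmetric] by simp
  qed
  have YN: "N (Y (Suc n)) \<le> inverse (real (Suc n))" for n
  proof -
    have "real (Suc n) * N (X (Suc n)) < l (Suc n)"
      using X(2)[of "Suc n"] by (simp add: l_def)
    then show ?thesis
      using l[of "Suc n"]
      by (simp add: Y_def is_norm_scaleR[OF N X(1)] field_simps)
  qed
  have "\<forall>D\<subseteq>{..<d}. \<exists>L :: nat \<Rightarrow> real. \<exists>r. strict_mono r \<and>
      (\<forall>e>0. eventually (\<lambda>n. \<forall>i\<in>D. dist (coord (Y (r n)) i) (L i) < e) sequentially)"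
  proof (rule compact_lemma_general[where unproj = "\<lambda>x. x"])
    fix k assume k: "k \<in> {..<d}"
    have "\<bar>coord (Y n) k\<bar> \<le> 1" for n
      using member_le_sum[of k "{..<d}" "\<lambda>i. \<bar>coord (Y n) i\<bar>"] k Y1[of n] by simp
    then show "bounded ((\<lambda>x. x k) ` range (\<lambda>n. coord (Y n)))"
      by (auto simp: bounded_iff)
  qed auto
  then obtain L :: "nat \<Rightarrow> real" and r where r: "strict_mono r"
    and "\<forall>e>0. eventually (\<lambda>n. \<forall>i\<in>{..<d}. dist (coord (Y (r n)) i) (L i) < e) sequentially"
    by blast
  then have lim: "(\<lambda>n. coord (Y (r n)) i) \<longlonglongrightarrow> L i" if "i < d" for i
    using that unfolding tendsto_iff by (fast intro: eventually_mono)
  define z where "z = (\<Sum>i<d. L i *\<^sub>R unit_rvec i)"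
  have z: "z \<in> Rd d"
    unfolding z_def by (auto intro!: Rd_sum Rd_scaleR unit_rvec_in_Rd)
  have zL: "coord z i = L i" if "i < d" for i
    using that by (simp add: z_def coord_sum if_distrib sum.delta cong: if_cong)
  have "(\<lambda>n. \<Sum>i<d. \<bar>coord (Y (r n)) i\<bar>) \<longlonglongrightarrow> (\<Sum>i<d. \<bar>L i\<bar>)"
    by (intro tendsto_intros lim) auto
  then have "(\<Sum>i<d. \<bar>L i\<bar>) = 1"
    by (simp add: Y1 LIMSEQ_const_iff)
  moreover have "N z \<le> 0"
  proof (rule LIMSEQ_le_const)
    let ?b = "\<lambda>n. (\<Sum>i<d. \<bar>L i - coord (Y (r (Suc n))) i\<bar> * N (unit_rvec i)) + inverse (real (Suc n))"
    have "(\<lambda>n. coord (Y (r (Suc n))) i) \<longlonglongrightarrow> L i" if "i < d" for i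
      using LIMSEQ_Suc[OF lim[OF that]] .
    then have "?b \<longlonglongrightarrow> (\<Sum>i<d. \<bar>L i - L i\<bar> * N (unit_rvec i)) + 0"
      by (intro tendsto_intros LIMSEQ_inverse_real_of_nat) auto
    then show "?b \<longlonglongrightarrow> 0"
      by simp
    have "N z \<le> ?b n" for n
    proof -
      have "N z = N ((z - Y (r (Suc n))) + Y (r (Suc n)))"
        by simp
      also have "\<dots> \<le> N (z - Y (r (Suc n))) + N (Y (r (Suc n)))"
        by (rule is_norm_triangle[OF N]) (auto intro: Rd_diff z Y)
      also have "N (z - Y (r (Suc n))) \<le> (\<Sum>i<d. \<bar>L i - coord (Y (r (Suc n))) i\<bar> * N (unit_rvec i))"
        using is_norm_coord_bound[OF N Rd_diff[OF z Y[of "r (Suc n)"]]] by (simp add: zL)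
      also have "N (Y (r (Suc n))) \<le> inverse (real (Suc n))"
      proof -
        have "Suc n \<le> r (Suc n)"
          by (rule seq_suble[OF r])
        then obtain m where m: "r (Suc n) = Suc m" "n \<le> m"
          by (cases "r (Suc n)") auto
        have "inverse (real (Suc m)) \<le> inverse (real (Suc n))"
          using m by (simp add: field_simps)
        then show ?thesis
          using YN[of m] m(1) by (metis order_trans)
      qed
      finally show ?thesis by simp
    qed
    then show "\<exists>M. \<forall>n\<ge>M. N z \<le> ?b n"
      by blast
  qed
  then have "z = 0"
    using is_norm_nonneg[OF N z] is_norm_eq_0[OF N z] by simp
  then have "L i = 0" if "i < d" for i
    using zL[OF that] by simp
  ultimately show False
    by simp
qed

lemma inner_eq_coord_sum:
  assumes "y \<in> Rd d"
  shows "x \<bullet> y = (\<Sum>i<d. coord x i * coord y i)"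
proof -
  have "y \<bullet> x = (\<Sum>i<d. coord y i * coord x i)"
    using assms by (intro inner_rvec_eq) (auto simp: Rd_def not_less[symmetric])
  then show ?thesis
    by (simp add: inner_commute mult.commute)
qed

lemma bdd_above_dual_norm:
  assumes N: "is_norm d N"
  shows "bdd_above ((\<lambda>y. x \<bullet> y) ` {y \<in> Rd d. N y \<le> 1})"
proof -
  obtain C where C: "\<And>x. x \<in> Rd d \<Longrightarrow> (\<Sum>i<d. \<bar>coord x i\<bar>) \<le> C * N x"
    using coord_sum_le_norm[OF N] by blast
  have "x \<bullet> y \<le> (\<Sum>i<d. \<bar>coord x i\<bar>) * \<bar>C\<bar>" if y: "y \<in> Rd d" "N y \<le> 1" for y
  proof -
    have "x \<bullet> y = (\<Sum>i<d. coord x i * coord y i)"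
      by (rule inner_eq_coord_sum[OF y(1)])
    also have "\<dots> \<le> (\<Sum>i<d. \<bar>coord x i\<bar> * (\<Sum>j<d. \<bar>coord y j\<bar>))"
    proof (rule sum_mono)
      fix i assume "i \<in> {..<d}"
      then have "\<bar>coord y i\<bar> \<le> (\<Sum>j<d. \<bar>coord y j\<bar>)"
        using member_le_sum[of i "{..<d}" "\<lambda>j. \<bar>coord y j\<bar>"] by simp
      then have "\<bar>coord x i\<bar> * \<bar>coord y i\<bar> \<le> \<bar>coord x i\<bar> * (\<Sum>j<d. \<bar>coord y j\<bar>)"
        by (intro mult_left_mono) auto
      then show "coord x i * coord y i \<le> \<bar>coord x i\<bar> * (\<Sum>j<d. \<bar>coord y j\<bar>)"
        using abs_ge_self[of "coord x i * coord y i"] by (simp add: abs_mult)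
    qed
    also have "\<dots> = (\<Sum>i<d. \<bar>coord x i\<bar>) * (\<Sum>j<d. \<bar>coord y j\<bar>)"
      by (simp add: sum_distrib_right)
    also have "\<dots> \<le> (\<Sum>i<d. \<bar>coord x i\<bar>) * \<bar>C\<bar>"
    proof (rule mult_left_mono)
      have "C * N y \<le> \<bar>C\<bar> * N y"
        using is_norm_nonneg[OF N y(1)] by (intro mult_right_mono) auto
      also have "\<dots> \<le> \<bar>C\<bar> * 1"
        using y(2) by (intro mult_left_mono) auto
      finally show "(\<Sum>j<d. \<bar>coord y j\<bar>) \<le> \<bar>C\<bar>"
        using C[OF y(1)] by simp
    qed (auto intro: sum_nonneg)
    finally show ?thesis .
  qed
  then show ?thesis
    by (auto intro!: bdd_aboveI)
qed

lemma dual_norm_upper: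
  assumes "is_norm d N" "y \<in> Rd d" "N y \<le> 1"
  shows "x \<bullet> y \<le> dual_norm d N x"
  unfolding dual_norm_def using assms by (intro cSUP_upper bdd_above_dual_norm) auto

lemma dual_norm_nonneg:
  assumes "is_norm d N"
  shows "0 \<le> dual_norm d N x"
  using dual_norm_upper[OF assms, of 0 x] is_norm_eq_0[OF assms, of 0] by simp

lemma inner_le_dual_norm:
  assumes N: "is_norm d N" and y: "y \<in> Rd d"
  shows "x \<bullet> y \<le> dual_norm d N x * N y"
proof (cases "y = 0")
  case True
  then show ?thesis
    using is_norm_eq_0[OF N y] by simp
next
  case False
  then have pos: "0 < N y"
    using is_norm_nonneg[OF N y] is_norm_eq_0[OF N y] by simp
  have "x \<bullet> (inverse (N y) *\<^sub>R y) \<le> dual_norm d N x"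
    using pos by (intro dual_norm_upper[OF N] Rd_scaleR y) (simp add: is_norm_scaleR[OF N y])
  then show ?thesis
    using pos by (simp add: field_simps)
qed

lemma dual_norm_triangle:
  assumes N: "is_norm d N"
  shows "dual_norm d N (x - y) \<le> dual_norm d N x + dual_norm d N y"
  unfolding dual_norm_def[of d N "x - y"]
proof (rule cSUP_least)
  show "{y \<in> Rd d. N y \<le> 1} \<noteq> {}"
    using is_norm_eq_0[OF N, of 0] by (auto intro!: exI[of _ 0])
  fix u assume u: "u \<in> {y \<in> Rd d. N y \<le> 1}"
  have "- y \<bullet> u = y \<bullet> ((-1) *\<^sub>R u)"
    by simp
  also have "\<dots> \<le> dual_norm d N y"
    using u is_norm_scaleR[OF N, of u "-1"] by (intro dual_norm_upper[OF N] Rd_scaleR) auto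
  finally show "(x - y) \<bullet> u \<le> dual_norm d N x + dual_norm d N y"
    using u dual_norm_upper[OF N, of u x] by (simp add: inner_diff_left)
qed

section \<open>Gradients along segments\<close>

lemma convex_segment:
  assumes "convex S" "x \<in> S" "y \<in> S" "0 \<le> s" "s \<le> 1"
  shows "y + s *\<^sub>R (x - y) \<in> S"
  using convexD_alt[OF assms(1,3,2,4,5)] by (simp add: algebra_simps)

text \<open>
  Gradients are only taken within \<open>S\<close>, so every use of them is reduced to the real function
  \<open>s \<mapsto> \<phi> (y + s (x - y))\<close> on \<open>[0, 1]\<close>, one-sided at the end points.
\<close>

lemma gradient_on_segment:
  assumes \<phi>: "gradient_on d S \<phi> D\<phi>" and S: "convex S" "x \<in> S" "y \<in> S" and s: "s \<in> {0..1}"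
  shows "((\<lambda>s. \<phi> (y + s *\<^sub>R (x - y))) has_real_derivative D\<phi> (y + s *\<^sub>R (x - y)) \<bullet> (x - y))
           (at s within {0..1})"
proof -
  let ?p = "\<lambda>s. y + s *\<^sub>R (x - y)"
  have "(\<phi> has_derivative (\<lambda>h. D\<phi> (?p s) \<bullet> h)) (at (?p s) within S)"
    using \<phi> convex_segment[OF S] s by (auto simp: gradient_on_def)
  moreover have "?p ` {0..1} \<subseteq> S"
    using convex_segment[OF S] by auto
  ultimately have *: "(\<phi> has_derivative (\<lambda>h. D\<phi> (?p s) \<bullet> h)) (at (?p s) within ?p ` {0..1})"
    by (rule has_derivative_subset)
  have "(?p has_derivative (\<lambda>h. h *\<^sub>R (x - y))) (at s within {0..1})"
    by (auto intro!: derivative_eq_intros)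
  from diff_chain_within[OF this *]
  show ?thesis
    by (simp add: has_field_derivative_def o_def mult_commute_abs)
qed

lemma gradient_on_directional_bound:
  assumes \<phi>: "gradient_on d S \<phi> D\<phi>" and S: "convex S" "x \<in> S" "y \<in> S"
    and c: "\<And>s. 0 < s \<Longrightarrow> s \<le> 1 \<Longrightarrow> \<phi> (y + s *\<^sub>R (x - y)) - \<phi> y \<le> s * c"
  shows "D\<phi> y \<bullet> (x - y) \<le> c"
proof -
  let ?h = "\<lambda>s. \<phi> (y + s *\<^sub>R (x - y))"
  have "((\<lambda>s. (?h s - ?h 0) / (s - 0)) \<longlongrightarrow> D\<phi> y \<bullet> (x - y)) (at 0 within {0..1})"
    using gradient_on_segment[OF \<phi> S, of 0] by (simp add: has_field_derivative_iff)
  moreover have "(0::real) islimpt {0..1}"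
    by simp
  then have "at (0::real) within {0..1} \<noteq> bot"
    by (simp add: trivial_limit_within)
  moreover have "\<forall>\<^sub>F s in at 0 within {0..1}. (?h s - ?h 0) / (s - 0) \<le> c"
    unfolding eventually_at_filter
    using c by (auto simp: field_simps intro!: always_eventually)
  ultimately show ?thesis
    using tendsto_upperbound by blast
qed

lemma convex_on_gradient_bound:
  assumes "gradient_on d S \<phi> D\<phi>" "convex S" "convex_on S \<phi>" "x \<in> S" "y \<in> S"
  shows "\<phi> y + D\<phi> y \<bullet> (x - y) \<le> \<phi> x"
proof -
  have "D\<phi> y \<bullet> (x - y) \<le> \<phi> x - \<phi> y"
  proof (rule gradient_on_directional_bound[OF assms(1,2,4,5)])
    fix s :: real assume "0 < s" "s \<le> 1"
    then have "\<phi> ((1 - s) *\<^sub>R y + s *\<^sub>R x) \<le> (1 - s) * \<phi> y + s * \<phi> x"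
      using convex_onD[OF assms(3), of s y x] assms by simp
    then show "\<phi> (y + s *\<^sub>R (x - y)) - \<phi> y \<le> s * (\<phi> x - \<phi> y)"
      by (simp add: algebra_simps)
  qed
  then show ?thesis by simp
qed

text \<open>
  Taylor's bound with only one derivative: \<open>\<phi> (y + s (x - y)) - s D\<phi> y \<bullet> (x - y) - c s\<^sup>2 / 2\<close> decreases
  in \<open>s\<close>.  It is used for the smooth constraints and, with \<open>- \<omega>\<close> and negative \<open>c\<close>, to turn the
  monotonicity of \<open>\<nabla>\<omega>\<close> into strong convexity.
\<close>

lemma gradient_on_quadratic_bound:
  assumes \<phi>: "gradient_on d S \<phi> D\<phi>" and S: "convex S" "x \<in> S" "y \<in> S"
    and c: "\<And>s. 0 < s \<Longrightarrow> s < 1 \<Longrightarrow> (D\<phi> (y + s *\<^sub>R (x - y)) - D\<phi> y) \<bullet> (x - y) \<le> c * s"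
  shows "\<phi> x \<le> \<phi> y + D\<phi> y \<bullet> (x - y) + c / 2"
proof -
  let ?h = "\<lambda>s. \<phi> (y + s *\<^sub>R (x - y)) - s * (D\<phi> y \<bullet> (x - y)) - c / 2 * s\<^sup>2"
  have deriv: "(?h has_real_derivative
      D\<phi> (y + s *\<^sub>R (x - y)) \<bullet> (x - y) - D\<phi> y \<bullet> (x - y) - c * s) (at s within {0..1})"
    if "s \<in> {0..1}" for s
    using that by (auto intro!: derivative_eq_intros gradient_on_segment[OF \<phi> S])
  have "?h 1 \<le> ?h 0"
  proof (rule DERIV_nonpos_imp_decreasing_open[where f = ?h])
    fix s :: real assume s: "0 < s" "s < 1"
    have "at s within {0..1} = at s"
      using s by (intro at_within_interior) (simp add: interior_atLeastAtMost_real)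
    then show "\<exists>y. DERIV ?h s :> y \<and> y \<le> 0"
      using deriv[of s] c[OF s] s by (auto simp: inner_diff_left)
  next
    show "continuous_on {0..1} ?h"
      using deriv by (intro DERIV_continuous_on) auto
  qed simp
  then show ?thesis by simp
qed

lemma gradient_on_scale:
  assumes "gradient_on d S \<phi> D\<phi>"
  shows "gradient_on d S (\<lambda>x. a * \<phi> x) (\<lambda>x. a *\<^sub>R D\<phi> x)"
  using assms unfolding gradient_on_def
  by (auto intro!: derivative_eq_intros Rd_scaleR)

section \<open>Dual iterates\<close>

text \<open>
  The dual variables as a function of the decisions alone.  Unlike those of a run of length \<open>T\<close> they
  also exist at time \<open>T + 1\<close>, where the drift of round \<open>T\<close> ends.
\<close>

primrec dual_iterate ::
  "(nat \<Rightarrow> rvec \<Rightarrow> real) \<Rightarrow> real \<Rightarrow> (nat \<Rightarrow> rvec) \<Rightarrow> nat \<Rightarrow> nat \<Rightarrow> real" where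
  "dual_iterate g \<gamma> x 0 = (\<lambda>k. 0)"
| "dual_iterate g \<gamma> x (Suc t) =
     (\<lambda>k. max (- \<gamma> * g k (x t)) (dual_iterate g \<gamma> x t k + \<gamma> * g k (x t)))"

lemma dual_iterate_nonneg: "0 \<le> dual_iterate g \<gamma> x t k"
proof (induction t)
  case (Suc t)
  show ?case
    using Suc by (cases "0 \<le> \<gamma> * g k (x t)") (auto simp: le_max_iff_disj)
qed simp

lemma dual_iterate_shift_nonneg: "0 \<le> dual_iterate g \<gamma> x (Suc t) k + \<gamma> * g k (x t)"
  using max.cobounded1[of "- \<gamma> * g k (x t)" "dual_iterate g \<gamma> x t k + \<gamma> * g k (x t)"] by simp

lemma dual_iterate_Suc_upper:
  "dual_iterate g \<gamma> x (Suc t) k \<le> dual_iterate g \<gamma> x t k + \<bar>\<gamma> * g k (x t)\<bar>"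
  using dual_iterate_nonneg[of g \<gamma> x t k] by (auto simp: max_def)

lemma dual_l1_nonneg: "0 \<le> dual_l1 K q"
  by (simp add: dual_l1_def sum_nonneg)

lemma dual_l1_dual_iterate: "dual_l1 K (dual_iterate g \<gamma> x t) = (\<Sum>k=1..K. dual_iterate g \<gamma> x t k)"
  by (simp add: dual_l1_def dual_iterate_nonneg)

text \<open>Drift of one dual variable \<open>q\<close>, with \<open>b = \<gamma> g\<^sub>k(x\<^sub>t)\<close>; the branch \<open>- b\<close> of the maximum costs \<open>b\<^sup>2\<close>.\<close>

lemma dual_drift:
  fixes q b :: real
  shows "(max (- b) (q + b))\<^sup>2 / 2 - q\<^sup>2 / 2 \<le> q * b + b\<^sup>2"
proof (cases "- b \<le> q + b")
  case True
  then show ?thesis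
    by (simp add: max_def power2_eq_square field_simps)
next
  case False
  have "0 \<le> (q + b)\<^sup>2"
    by simp
  then show ?thesis
    using False by (simp add: max_def power2_eq_square field_simps)
qed

lemma sum_square_le_square_sum:
  fixes a :: "nat \<Rightarrow> real"
  assumes "\<And>k. k \<in> I \<Longrightarrow> 0 \<le> a k"
  shows "(\<Sum>k\<in>I. (a k)\<^sup>2) \<le> (\<Sum>k\<in>I. a k)\<^sup>2"
proof (cases "finite I")
  case True
  have "(\<Sum>k\<in>I. (a k)\<^sup>2) \<le> (\<Sum>k\<in>I. a k * (\<Sum>j\<in>I. a j))"
    using assms True
    by (intro sum_mono) (auto simp: power2_eq_square intro!: mult_left_mono member_le_sum)
  then show ?thesis
    by (simp add: power2_eq_square sum_distrib_right)
qed simp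

section \<open>One round of the algorithm\<close>

locale mirror_prox =
  constrained_oco d N X0 f df K g dg F L\<^sub>f G Hk L\<^sub>g + distance_generating d N X0 \<omega> d\<omega> \<rho>
  for d N X0 f df K g dg F L\<^sub>f G Hk L\<^sub>g \<omega> d\<omega> \<rho> +
  fixes H R \<gamma> \<eta> :: real and \<alpha> :: "nat \<Rightarrow> real" and T :: nat
    and x xt :: "nat \<Rightarrow> rvec" and Q :: "nat \<Rightarrow> nat \<Rightarrow> real"
  assumes H_eq: "H = (\<Sum>k=1..K. Hk k)"
    and bregman_le: "\<And>u v. u \<in> X0 \<Longrightarrow> v \<in> X0 \<Longrightarrow> bregman \<omega> d\<omega> u v \<le> R\<^sup>2"
    and \<gamma>_pos: "0 < \<gamma>" and \<eta>_pos: "0 < \<eta>"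
    and run: "mirror_prox_run X0 df K g dg \<omega> d\<omega> \<gamma> \<alpha> T x xt Q"
    and \<alpha>_0: "\<alpha> 0 = 0"
    and \<alpha>_step: "\<And>t. t \<in> {1..T} \<Longrightarrow> \<alpha> t =
      max (2 * inverse \<rho> * (\<gamma>\<^sup>2 * L\<^sub>g * G + \<eta> * L\<^sub>f\<^sup>2 + inverse \<eta>
             + (\<gamma> * L\<^sub>g * dual_l1 K (Q t) + \<gamma>\<^sup>2 * (L\<^sub>g * G + H\<^sup>2)))) (\<alpha> (t - 1))"
begin

abbreviation dual :: "nat \<Rightarrow> nat \<Rightarrow> real" where
  "dual \<equiv> dual_iterate g \<gamma> x"

abbreviation D :: "rvec \<Rightarrow> rvec \<Rightarrow> real" where
  "D \<equiv> bregman \<omega> d\<omega>"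

definition \<xi> :: "nat \<Rightarrow> real" where
  "\<xi> t = \<gamma> * L\<^sub>g * dual_l1 K (dual t) + \<gamma>\<^sup>2 * (L\<^sub>g * G + H\<^sup>2)"

lemma Q_eq_dual: "t \<le> T \<Longrightarrow> k \<in> {1..K} \<Longrightarrow> Q t k = dual t k"
proof (induction t)
  case 0
  then show ?case using run by (simp add: mirror_prox_run_def)
next
  case (Suc t)
  then have "Suc t \<in> {1..T}"
    by simp
  with run Suc show ?case
    unfolding mirror_prox_run_def by fastforce
qed

lemma dual_l1_Q: "t \<le> T \<Longrightarrow> dual_l1 K (Q t) = dual_l1 K (dual t)"
  by (simp add: dual_l1_def Q_eq_dual)

lemma \<alpha>_eq:
  assumes "t \<in> {1..T}"
  shows "\<alpha> t = max (2 * inverse \<rho> * (\<gamma>\<^sup>2 * L\<^sub>g * G + \<eta> * L\<^sub>f\<^sup>2 + inverse \<eta> + \<xi> t)) (\<alpha> (t - 1))"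
  using \<alpha>_step[OF assms] assms by (simp add: \<xi>_def dual_l1_Q)

lemma iterate_in_X0: "t \<le> T \<Longrightarrow> x t \<in> X0"
  using run by (cases t) (auto simp: mirror_prox_run_def is_arg_min_def)

lemma center_in_X0: "1 \<le> t \<Longrightarrow> t \<le> T + 1 \<Longrightarrow> xt t \<in> X0"
proof (cases "t = 1")
  case False
  assume "1 \<le> t" "t \<le> T + 1"
  then have "t - 1 \<in> {1..T}" "t - 1 + 1 = t"
    using False by auto
  then show "xt t \<in> X0"
    using run unfolding mirror_prox_run_def is_arg_min_def by metis
qed (use run in \<open>simp add: mirror_prox_run_def\<close>)

lemma X0_diff_in_Rd: "u \<in> X0 \<Longrightarrow> v \<in> X0 \<Longrightarrow> u - v \<in> Rd d"
  using X0_sub by (auto intro: Rd_diff)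

lemma N_nonneg: "u \<in> X0 \<Longrightarrow> v \<in> X0 \<Longrightarrow> 0 \<le> N (u - v)"
  by (intro is_norm_nonneg[OF norm_N] X0_diff_in_Rd)

lemma N_commute: "u \<in> X0 \<Longrightarrow> v \<in> X0 \<Longrightarrow> N (u - v) = N (v - u)"
  using X0_sub by (intro is_norm_minus_commute[OF norm_N]) auto

lemma N_triangle:
  assumes "u \<in> X0" "v \<in> X0" "z \<in> X0"
  shows "N (u - v) \<le> N (u - z) + N (z - v)"
  using is_norm_triangle[OF norm_N X0_diff_in_Rd[OF assms(1,3)] X0_diff_in_Rd[OF assms(3,2)]]
  by simp

lemma G_nonneg: "0 \<le> G"
  using g_bound[OF iterate_in_X0[of 0]] by (smt (verit) sum_nonneg abs_ge_zero le0)

lemma F_nonneg: "0 \<le> F"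
  using df_bound[OF iterate_in_X0[of 0]] dual_norm_nonneg[OF norm_N] order_trans by blast

lemma \<xi>_nonneg: "0 \<le> \<xi> t"
  unfolding \<xi>_def using \<gamma>_pos Lg_nonneg G_nonneg
  by (intro add_nonneg_nonneg mult_nonneg_nonneg dual_l1_nonneg) auto

lemma bregman_lower:
  assumes "u \<in> X0" "v \<in> X0"
  shows "\<rho> / 2 * (N (u - v))\<^sup>2 \<le> D u v"
proof -
  have *: "((-1) *\<^sub>R d\<omega> (v + s *\<^sub>R (u - v)) - (-1) *\<^sub>R d\<omega> v) \<bullet> (u - v) \<le> (- \<rho> * (N (u - v))\<^sup>2) * s"
    if s: "0 < s" "s < 1" for s
  proof -
    let ?p = "v + s *\<^sub>R (u - v)"
    have "\<rho> * (N (?p - v))\<^sup>2 \<le> (?p - v) \<bullet> (d\<omega> ?p - d\<omega> v)"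
      using s assms by (intro strongly_convex convex_segment X0_convex) auto
    then have "s * (\<rho> * (s * (N (u - v))\<^sup>2)) \<le> s * ((u - v) \<bullet> (d\<omega> ?p - d\<omega> v))"
      using s by (simp add: is_norm_scaleR[OF norm_N X0_diff_in_Rd[OF assms]] power2_eq_square mult_ac)
    then have "\<rho> * (s * (N (u - v))\<^sup>2) \<le> (u - v) \<bullet> (d\<omega> ?p - d\<omega> v)"
      using s by simp
    then show ?thesis
      by (simp add: inner_diff_left inner_diff_right inner_commute algebra_simps)
  qed
  have "(-1) * \<omega> u \<le> (-1) * \<omega> v + ((-1) *\<^sub>R d\<omega> v) \<bullet> (u - v) + (- \<rho> * (N (u - v))\<^sup>2) / 2"
    by (rule gradient_on_quadratic_bound[OF gradient_on_scale[OF \<omega>_gradient] X0_convex assms *])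
  then show ?thesis
    by (simp add: bregman_def)
qed

lemma bregman_nonneg: "u \<in> X0 \<Longrightarrow> v \<in> X0 \<Longrightarrow> 0 \<le> D u v"
  using bregman_lower[of u v] \<rho>_pos by (smt (verit) mult_nonneg_nonneg zero_le_power2 half_gt_zero)

lemma N_square_le: "u \<in> X0 \<Longrightarrow> v \<in> X0 \<Longrightarrow> (N (u - v))\<^sup>2 \<le> 2 * R\<^sup>2 * inverse \<rho>"
  using bregman_lower[of u v] bregman_le[of u v] \<rho>_pos by (simp add: field_simps)

text \<open>
  First-order optimality of the minimiser \<open>m\<close> in the direction \<open>u - m\<close>, combined with the three-point
  identity \<open>D u z - D u m - D m z = (d\<omega> m - d\<omega> z) \<bullet> (u - m)\<close>.
\<close>

lemma prox_three_point:
  assumes m: "is_arg_min (\<lambda>u. p \<bullet> u + a * D u z) (\<lambda>u. u \<in> X0) m"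
    and u: "u \<in> X0"
  shows "p \<bullet> (m - u) \<le> a * (D u z - D u m - D m z)"
proof -
  have mX: "m \<in> X0"
    using m by (simp add: is_arg_min_def)
  have "((- a) *\<^sub>R d\<omega> m) \<bullet> (u - m) \<le> (p - a *\<^sub>R d\<omega> z) \<bullet> (u - m)"
  proof (rule gradient_on_directional_bound[OF gradient_on_scale[OF \<omega>_gradient] X0_convex u mX])
    fix s :: real assume s: "0 < s" "s \<le> 1"
    have "m + s *\<^sub>R (u - m) \<in> X0"
      using s u mX by (intro convex_segment X0_convex) auto
    then have "p \<bullet> m + a * D m z \<le> p \<bullet> (m + s *\<^sub>R (u - m)) + a * D (m + s *\<^sub>R (u - m)) z"
      using m by (auto simp: is_arg_min_def not_less)
    then show "- a * \<omega> (m + s *\<^sub>R (u - m)) - - a * \<omega> m \<le> s * ((p - a *\<^sub>R d\<omega> z) \<bullet> (u - m))"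
      by (simp add: bregman_def inner_add_right inner_diff_right inner_diff_left algebra_simps)
  qed
  then show ?thesis
    by (simp add: bregman_def inner_diff_right inner_diff_left algebra_simps)
qed

text \<open>
  The vector \<open>\<Sum>\<^sub>k (Q\<^sub>k(t) + \<gamma> g\<^sub>k(x\<^sub>t\<^sub>-\<^sub>1)) \<gamma> \<nabla>g\<^sub>k(x\<^sub>t\<^sub>-\<^sub>1)\<close> by which the constraints enter both primal steps.
\<close>

definition constraint_force :: "nat \<Rightarrow> rvec" where
  "constraint_force t = (\<Sum>k=1..K. ((dual t k + \<gamma> * g k (x (t - 1))) * \<gamma>) *\<^sub>R dg k (x (t - 1)))"

lemma prox_objective_linear:
  assumes "t \<in> {1..T}"
  shows "prox_objective \<omega> d\<omega> K g dg \<gamma> v (Q t) (x (t - 1)) a z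
       = (\<lambda>u. (v + constraint_force t) \<bullet> u + a * D u z)"
  using assms
  by (auto simp: fun_eq_iff prox_objective_def constraint_force_def inner_add_left inner_sum_left
      Q_eq_dual mult.assoc intro!: sum.cong)

lemma mirror_prox_inequality:
  assumes t: "t \<in> {1..T}" and u: "u \<in> X0"
  shows "(df t (x t) + constraint_force t) \<bullet> (x t - u)
    \<le> (df t (x t) - df (t - 1) (x (t - 1))) \<bullet> (x t - xt (t + 1))
      + \<alpha> t * (D u (xt t) - D u (xt (t + 1)) - D (xt (t + 1)) (x t) - D (x t) (xt t))"
proof -
  have "is_arg_min (\<lambda>u. (df (t - 1) (x (t - 1)) + constraint_force t) \<bullet> u + \<alpha> t * D u (xt t))
      (\<lambda>u. u \<in> X0) (x t)"
    and "is_arg_min (\<lambda>u. (df t (x t) + constraint_force t) \<bullet> u + \<alpha> t * D u (xt t))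
      (\<lambda>u. u \<in> X0) (xt (t + 1))"
    using run t unfolding mirror_prox_run_def prox_objective_linear[OF t, symmetric] by auto
  moreover have "xt (t + 1) \<in> X0"
    using t by (intro center_in_X0) auto
  ultimately have
    "(df (t - 1) (x (t - 1)) + constraint_force t) \<bullet> (x t - xt (t + 1))
       \<le> \<alpha> t * (D (xt (t + 1)) (xt t) - D (xt (t + 1)) (x t) - D (x t) (xt t))"
    "(df t (x t) + constraint_force t) \<bullet> (xt (t + 1) - u)
       \<le> \<alpha> t * (D u (xt t) - D u (xt (t + 1)) - D (xt (t + 1)) (xt t))"
    using u by (auto intro!: prox_three_point)
  then show ?thesis
    by (simp add: inner_add_left inner_diff_left inner_diff_right algebra_simps)
qed

text \<open>
  One constraint's share of the force pays for the dual drift.  The descent bound at \<open>y\<close> and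
  convexity replace \<open>\<nabla>g\<^sub>k(y) \<bullet> (v - u)\<close> by \<open>g\<^sub>k(v) - g\<^sub>k(u)\<close>, and
  \<open>g\<^sub>k(y) g\<^sub>k(v) - g\<^sub>k(v)\<^sup>2\<close> is a telescoping term minus \<open>(g\<^sub>k(y) - g\<^sub>k(v))\<^sup>2 / 2\<close>.
\<close>

lemma constraint_drift:
  assumes k: "k \<in> {1..K}" and X0: "y \<in> X0" "v \<in> X0" "u \<in> X0"
    and q: "0 \<le> q + \<gamma> * g k y"
  shows "(max (- \<gamma> * g k v) (q + \<gamma> * g k v))\<^sup>2 / 2 - q\<^sup>2 / 2 - \<gamma>\<^sup>2 / 2 * ((g k v)\<^sup>2 - (g k y)\<^sup>2)
      - (\<gamma> * L\<^sub>g * (q + \<gamma> * g k y) + \<gamma>\<^sup>2 * (Hk k)\<^sup>2) / 2 * (N (v - y))\<^sup>2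
      - \<gamma> * ((q + \<gamma> * g k y) * g k u)
    \<le> (q + \<gamma> * g k y) * \<gamma> * (dg k y \<bullet> (v - u))"
proof -
  let ?c = "q + \<gamma> * g k y"
  have "g k v \<le> g k y + dg k y \<bullet> (v - y) + (L\<^sub>g * (N (v - y))\<^sup>2) / 2"
  proof (rule gradient_on_quadratic_bound[OF g_gradient[OF k] X0_convex X0(2,1)])
    fix s :: real assume s: "0 < s" "s < 1"
    let ?p = "y + s *\<^sub>R (v - y)"
    have p: "?p \<in> X0"
      using s X0 by (intro convex_segment X0_convex) auto
    have "(dg k ?p - dg k y) \<bullet> (v - y) \<le> dual_norm d N (dg k ?p - dg k y) * N (v - y)"
      by (intro inner_le_dual_norm[OF norm_N] X0_diff_in_Rd X0)
    also have "\<dots> \<le> (L\<^sub>g * N (?p - y)) * N (v - y)"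
      by (intro mult_right_mono dg_lipschitz[OF k p] N_nonneg X0)
    also have "\<dots> = L\<^sub>g * (N (v - y))\<^sup>2 * s"
      using s by (simp add: is_norm_scaleR[OF norm_N X0_diff_in_Rd[OF X0(2,1)]] power2_eq_square)
    finally show "(dg k ?p - dg k y) \<bullet> (v - y) \<le> L\<^sub>g * (N (v - y))\<^sup>2 * s" .
  qed
  moreover have "g k y + dg k y \<bullet> (u - y) \<le> g k u"
    by (rule convex_on_gradient_bound[OF g_gradient[OF k] X0_convex g_convex[OF k] X0(3,1)])
  ultimately have "g k v - g k u - L\<^sub>g * (N (v - y))\<^sup>2 / 2 \<le> dg k y \<bullet> (v - u)"
    by (simp add: inner_diff_right)
  then have 1: "(?c * \<gamma>) * (g k v - g k u - L\<^sub>g * (N (v - y))\<^sup>2 / 2) \<le> (?c * \<gamma>) * (dg k y \<bullet> (v - u))"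
    using q \<gamma>_pos by (intro mult_left_mono) auto
  have 2: "(max (- \<gamma> * g k v) (q + \<gamma> * g k v))\<^sup>2 / 2 - q\<^sup>2 / 2 \<le> q * (\<gamma> * g k v) + (\<gamma> * g k v)\<^sup>2"
    using dual_drift[of "\<gamma> * g k v" q] by simp
  have "\<bar>g k v - g k y\<bar>\<^sup>2 \<le> (Hk k * N (v - y))\<^sup>2"
    by (intro power_mono g_lipschitz[OF k] X0) auto
  then have 3: "\<gamma>\<^sup>2 / 2 * (g k v - g k y)\<^sup>2 \<le> \<gamma>\<^sup>2 / 2 * ((Hk k)\<^sup>2 * (N (v - y))\<^sup>2)"
    by (intro mult_left_mono) (auto simp: power_mult_distrib)
  define M where "M = (max (- \<gamma> * g k v) (q + \<gamma> * g k v))\<^sup>2"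
  show ?thesis
    using 1 2 3 unfolding M_def[symmetric] by (simp add: power2_eq_square field_simps)
qed

lemma constraint_force_drift:
  assumes t: "t \<in> {1..T}" and u: "u \<in> X0"
  shows "(\<Sum>k=1..K. (dual (t + 1) k)\<^sup>2) / 2 - (\<Sum>k=1..K. (dual t k)\<^sup>2) / 2
      - \<gamma>\<^sup>2 / 2 * ((\<Sum>k=1..K. (g k (x t))\<^sup>2) - (\<Sum>k=1..K. (g k (x (t - 1)))\<^sup>2))
      - \<xi> t / 2 * (N (x t - x (t - 1)))\<^sup>2
      - \<gamma> * (\<Sum>k=1..K. (dual t k + \<gamma> * g k (x (t - 1))) * g k u)
    \<le> constraint_force t \<bullet> (x t - u)"
proof -
  let ?y = "x (t - 1)" and ?n = "(N (x t - x (t - 1)))\<^sup>2"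
  let ?c = "\<lambda>k. dual t k + \<gamma> * g k ?y"
  have X: "?y \<in> X0" "x t \<in> X0"
    using t by (auto intro: iterate_in_X0)
  have c: "0 \<le> ?c k" for k
    using dual_iterate_shift_nonneg[of g \<gamma> x "t - 1" k] t
    by (simp del: dual_iterate.simps)
  have "(\<Sum>k=1..K. ?c k) \<le> dual_l1 K (dual t) + \<gamma> * G"
  proof -
    have "(\<Sum>k=1..K. g k ?y) \<le> G"
      using g_bound[OF X(1)] sum_mono[of "{1..K}" "\<lambda>k. g k ?y" "\<lambda>k. \<bar>g k ?y\<bar>"] by force
    then have "\<gamma> * (\<Sum>k=1..K. g k ?y) \<le> \<gamma> * G"
      using \<gamma>_pos by (intro mult_left_mono) auto
    then show ?thesis
      by (simp add: sum.distrib sum_distrib_left dual_l1_dual_iterate)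
  qed
  then have a: "\<gamma> * L\<^sub>g * (\<Sum>k=1..K. ?c k) \<le> \<gamma> * L\<^sub>g * (dual_l1 K (dual t) + \<gamma> * G)"
    using \<gamma>_pos Lg_nonneg by (intro mult_left_mono) auto
  have "(\<Sum>k=1..K. (Hk k)\<^sup>2) \<le> H\<^sup>2"
    unfolding H_eq by (rule sum_square_le_square_sum) (rule Hk_nonneg)
  then have b: "\<gamma>\<^sup>2 * (\<Sum>k=1..K. (Hk k)\<^sup>2) \<le> \<gamma>\<^sup>2 * H\<^sup>2"
    by (intro mult_left_mono) auto
  have "(\<Sum>k=1..K. \<gamma> * L\<^sub>g * ?c k + \<gamma>\<^sup>2 * (Hk k)\<^sup>2) \<le> \<xi> t"
    using a b unfolding \<xi>_def
    by (simp only: sum.distrib sum_distrib_left[symmetric]) (simp add: power2_eq_square algebra_simps)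
  then have \<xi>: "(\<Sum>k=1..K. \<gamma> * L\<^sub>g * ?c k + \<gamma>\<^sup>2 * (Hk k)\<^sup>2) / 2 * ?n \<le> \<xi> t / 2 * ?n"
    by (intro mult_right_mono) auto
  have "(\<Sum>k=1..K. (dual (t + 1) k)\<^sup>2 / 2 - (dual t k)\<^sup>2 / 2 - \<gamma>\<^sup>2 / 2 * ((g k (x t))\<^sup>2 - (g k ?y)\<^sup>2)
      - (\<gamma> * L\<^sub>g * ?c k + \<gamma>\<^sup>2 * (Hk k)\<^sup>2) / 2 * ?n - \<gamma> * (?c k * g k u))
    \<le> (\<Sum>k=1..K. ?c k * \<gamma> * (dg k ?y \<bullet> (x t - u)))"
    by (intro sum_mono) (use constraint_drift[OF _ X u c] in simp)
  also have "\<dots> = constraint_force t \<bullet> (x t - u)"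
    by (simp add: constraint_force_def inner_sum_left)
  finally show ?thesis
    using \<xi>
    by (simp only: sum_subtractf sum_divide_distrib[symmetric] sum_distrib_left[symmetric]
        sum_distrib_right[symmetric])
qed

lemma dual_l1_Suc:
  assumes "t \<le> T"
  shows "dual_l1 K (dual (Suc t)) \<le> dual_l1 K (dual t) + \<gamma> * G"
proof -
  have "(\<Sum>k=1..K. \<bar>\<gamma> * g k (x t)\<bar>) \<le> \<gamma> * G"
    using g_bound[OF iterate_in_X0[OF assms]] \<gamma>_pos
    by (simp add: abs_mult sum_distrib_left[symmetric])
  moreover have "dual_l1 K (dual (Suc t)) \<le> (\<Sum>k=1..K. dual t k + \<bar>\<gamma> * g k (x t)\<bar>)"
    unfolding dual_l1_dual_iterate by (intro sum_mono dual_iterate_Suc_upper)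
  ultimately show ?thesis
    by (simp add: sum.distrib dual_l1_dual_iterate)
qed

lemma \<xi>_Suc: "t \<le> T \<Longrightarrow> \<xi> (Suc t) \<le> \<xi> t + \<gamma>\<^sup>2 * L\<^sub>g * G"
  using mult_left_mono[OF dual_l1_Suc, of t "\<gamma> * L\<^sub>g"] \<gamma>_pos Lg_nonneg
  by (simp add: \<xi>_def power2_eq_square algebra_simps)

text \<open>Young's inequality with weight \<open>\<eta>\<close>, applied to the two sources of change of the gradient.\<close>

lemma prediction_error:
  assumes t: "t \<in> {1..T}" and z: "z \<in> X0"
  shows "(df t (x t) - df (t - 1) (x (t - 1))) \<bullet> (x t - z)
    \<le> \<eta> / 2 * (dual_norm d N (df t (x (t - 1)) - df (t - 1) (x (t - 1))))\<^sup>2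
      + \<eta> * L\<^sub>f\<^sup>2 / 2 * (N (x t - x (t - 1)))\<^sup>2 + inverse \<eta> * (N (x t - z))\<^sup>2"
proof -
  let ?y = "x (t - 1)"
  let ?e = "dual_norm d N (df t ?y - df (t - 1) ?y)" and ?m = "N (x t - ?y)" and ?n = "N (x t - z)"
  have X: "?y \<in> X0" "x t \<in> X0"
    using t by (auto intro: iterate_in_X0)
  have young: "a * ?n \<le> \<eta> / 2 * a\<^sup>2 + inverse \<eta> / 2 * ?n\<^sup>2" for a
  proof -
    have "0 \<le> inverse \<eta> / 2 * (\<eta> * a - ?n)\<^sup>2"
      using \<eta>_pos by simp
    also have "\<dots> = \<eta> / 2 * a\<^sup>2 + inverse \<eta> / 2 * ?n\<^sup>2 - a * ?n"
      using \<eta>_pos by (simp add: power2_eq_square field_simps)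
    finally show ?thesis by simp
  qed
  have "(df t ?y - df (t - 1) ?y) \<bullet> (x t - z) \<le> ?e * ?n"
    by (intro inner_le_dual_norm[OF norm_N] X0_diff_in_Rd X z)
  moreover have "(df t (x t) - df t ?y) \<bullet> (x t - z) \<le> (L\<^sub>f * ?m) * ?n"
    using inner_le_dual_norm[OF norm_N X0_diff_in_Rd[OF X(2) z]]
      mult_right_mono[OF df_lipschitz[OF X(2,1)] N_nonneg[OF X(2) z]] order_trans by blast
  ultimately show ?thesis
    using young[of ?e] young[of "L\<^sub>f * ?m"]
    by (simp add: inner_diff_left power_mult_distrib)
qed

lemma \<alpha>_nonneg: "t \<le> T \<Longrightarrow> 0 \<le> \<alpha> t"
  by (induction t) (auto simp: \<alpha>_0 \<alpha>_eq le_max_iff_disj)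

lemma \<alpha>_bregman_lower:
  assumes t: "t \<in> {1..T}" and uv: "u \<in> X0" "v \<in> X0"
  shows "(\<gamma>\<^sup>2 * L\<^sub>g * G + \<eta> * L\<^sub>f\<^sup>2 + inverse \<eta> + \<xi> t) * (N (u - v))\<^sup>2 \<le> \<alpha> t * D u v"
proof -
  have "\<gamma>\<^sup>2 * L\<^sub>g * G + \<eta> * L\<^sub>f\<^sup>2 + inverse \<eta> + \<xi> t \<le> \<alpha> t * (\<rho> / 2)"
  proof -
    have "2 * inverse \<rho> * (\<gamma>\<^sup>2 * L\<^sub>g * G + \<eta> * L\<^sub>f\<^sup>2 + inverse \<eta> + \<xi> t) \<le> \<alpha> t"
      unfolding \<alpha>_eq[OF t] by (rule max.cobounded1)
    then have "\<rho> / 2 * (2 * inverse \<rho> * (\<gamma>\<^sup>2 * L\<^sub>g * G + \<eta> * L\<^sub>f\<^sup>2 + inverse \<eta> + \<xi> t)) \<le> \<rho> / 2 * \<alpha> t"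
      using \<rho>_pos by (intro mult_left_mono) auto
    moreover have "\<rho> / 2 * (2 * inverse \<rho> * a) = a" for a
      using \<rho>_pos by simp
    ultimately show ?thesis
      by (metis mult.commute)
  qed
  then have "(\<gamma>\<^sup>2 * L\<^sub>g * G + \<eta> * L\<^sub>f\<^sup>2 + inverse \<eta> + \<xi> t) * (N (u - v))\<^sup>2 \<le> \<alpha> t * (\<rho> / 2) * (N (u - v))\<^sup>2"
    by (intro mult_right_mono) auto
  also have "\<dots> \<le> \<alpha> t * D u v"
    using bregman_lower[OF uv] \<alpha>_nonneg[of t] t by (simp add: mult.assoc mult_left_mono)
  finally show ?thesis .
qed

text \<open>
  Everything on the right-hand side telescopes, is part of the gradient variation, or is controlled
  by the choice of the comparator \<open>u\<close>.  The negative Bregman terms of the mirror-prox inequality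
  absorb the movement of the iterates: \<open>x\<^sub>t - x\<^sub>t\<^sub>-\<^sub>1\<close> is split at the prox centre of round \<open>t\<close>; one part
  is absorbed at once, the other one by the preceding round, because \<open>\<xi>\<close> grows by at most
  \<open>\<gamma>\<^sup>2 L\<^sub>g G\<close> per round.  This growth is the reason for the first summand of \<open>\<alpha>\<^sub>t\<close>.
\<close>

lemma one_round:
  assumes t: "t \<in> {1..T}" and u: "u \<in> X0"
  shows "f t (x t) - f t u + (\<Sum>k=1..K. (dual (Suc t) k)\<^sup>2) / 2 - (\<Sum>k=1..K. (dual t k)\<^sup>2) / 2
    \<le> \<eta> / 2 * (dual_norm d N (df t (x (t - 1)) - df (t - 1) (x (t - 1))))\<^sup>2
      + \<alpha> t * (D u (xt t) - D u (xt (Suc t)))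
      + \<gamma>\<^sup>2 / 2 * ((\<Sum>k=1..K. (g k (x t))\<^sup>2) - (\<Sum>k=1..K. (g k (x (t - 1)))\<^sup>2))
      + (\<xi> t + \<eta> * L\<^sub>f\<^sup>2) * (N (xt t - x (t - 1)))\<^sup>2
      - (\<xi> (Suc t) + \<eta> * L\<^sub>f\<^sup>2) * (N (xt (Suc t) - x t))\<^sup>2
      + \<gamma> * (\<Sum>k=1..K. (dual t k + \<gamma> * g k (x (t - 1))) * g k u)"
proof -
  let ?y = "x (t - 1)" and ?z = "xt t" and ?z' = "xt (Suc t)"
  let ?n = "(N (x t - ?y))\<^sup>2" and ?a = "(N (x t - ?z))\<^sup>2" and ?b = "(N (?z - ?y))\<^sup>2"
    and ?b' = "(N (?z' - x t))\<^sup>2"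
  have X: "?y \<in> X0" "x t \<in> X0" "?z \<in> X0" "?z' \<in> X0"
    using t by (auto intro: iterate_in_X0 center_in_X0)
  have "f t (x t) + df t (x t) \<bullet> (u - x t) \<le> f t u"
    by (rule convex_on_gradient_bound[OF f_gradient X0_convex f_convex u X(2)])
  then have loss: "f t (x t) - f t u \<le> df t (x t) \<bullet> (x t - u)"
    by (simp add: inner_diff_right)
  have "?n \<le> (N (x t - ?z) + N (?z - ?y))\<^sup>2"
    by (intro power_mono N_triangle N_nonneg X)
  also have "\<dots> \<le> 2 * ?a + 2 * ?b"
    using zero_le_power2[of "N (x t - ?z) - N (?z - ?y)"] by (simp add: power2_eq_square algebra_simps)
  finally have "(\<xi> t + \<eta> * L\<^sub>f\<^sup>2) / 2 * ?n \<le> (\<xi> t + \<eta> * L\<^sub>f\<^sup>2) / 2 * (2 * ?a + 2 * ?b)"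
    using \<xi>_nonneg[of t] \<eta>_pos by (intro mult_left_mono) auto
  then have movement: "\<xi> t / 2 * ?n + \<eta> * L\<^sub>f\<^sup>2 / 2 * ?n \<le> (\<xi> t + \<eta> * L\<^sub>f\<^sup>2) * ?a + (\<xi> t + \<eta> * L\<^sub>f\<^sup>2) * ?b"
    by (simp add: field_simps)
  have absorb1: "(\<xi> t + \<eta> * L\<^sub>f\<^sup>2) * ?a \<le> \<alpha> t * D (x t) ?z"
  proof -
    have "0 \<le> (\<gamma>\<^sup>2 * L\<^sub>g * G + inverse \<eta>) * ?a"
      using Lg_nonneg G_nonneg \<eta>_pos by simp
    then show ?thesis
      using \<alpha>_bregman_lower[OF t X(2,3)] by (simp add: algebra_simps)
  qed
  have "(\<xi> (Suc t) + \<eta> * L\<^sub>f\<^sup>2 + inverse \<eta>) * ?b' \<le> (\<gamma>\<^sup>2 * L\<^sub>g * G + \<eta> * L\<^sub>f\<^sup>2 + inverse \<eta> + \<xi> t) * ?b'"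
    using \<xi>_Suc[of t] t by (intro mult_right_mono) auto
  also have "\<dots> \<le> \<alpha> t * D ?z' (x t)"
    by (rule \<alpha>_bregman_lower[OF t X(4,2)])
  finally have absorb2: "(\<xi> (Suc t) + \<eta> * L\<^sub>f\<^sup>2) * ?b' + inverse \<eta> * ?b' \<le> \<alpha> t * D ?z' (x t)"
    by (simp add: algebra_simps)
  have error: "(df t (x t) - df (t - 1) ?y) \<bullet> (x t - ?z')
    \<le> \<eta> / 2 * (dual_norm d N (df t ?y - df (t - 1) ?y))\<^sup>2 + \<eta> * L\<^sub>f\<^sup>2 / 2 * ?n + inverse \<eta> * ?b'"
    using prediction_error[OF t X(4)] N_commute[OF X(2,4)] by simp
  have prox: "df t (x t) \<bullet> (x t - u) + constraint_force t \<bullet> (x t - u)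
    \<le> (df t (x t) - df (t - 1) ?y) \<bullet> (x t - ?z')
      + \<alpha> t * (D u ?z - D u ?z') - \<alpha> t * D ?z' (x t) - \<alpha> t * D (x t) ?z"
    using mirror_prox_inequality[OF t u] by (simp add: inner_add_left right_diff_distrib)
  show ?thesis
    using loss movement absorb1 absorb2 error prox constraint_force_drift[OF t u] by simp
qed

end

section \<open>Summation over consecutive rounds\<close>

context constrained_oco
begin

lemma gradient_change_le_SUP:
  assumes "y \<in> X0"
  shows "(dual_norm d N (df t y - df (t - 1) y))\<^sup>2
       \<le> (SUP u\<in>X0. (dual_norm d N (df t u - df (t - 1) u))\<^sup>2)"
proof (rule cSUP_upper[OF assms])
  have "(dual_norm d N (df t u - df (t - 1) u))\<^sup>2 \<le> (F + F)\<^sup>2" if "u \<in> X0" for u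
  proof (rule power_mono)
    show "dual_norm d N (df t u - df (t - 1) u) \<le> F + F"
      using dual_norm_triangle[OF norm_N, of "df t u" "df (t - 1) u"] df_bound[OF that, of t]
        df_bound[OF that, of "t - 1"] by linarith
  qed (rule dual_norm_nonneg[OF norm_N])
  then show "bdd_above ((\<lambda>u. (dual_norm d N (df t u - df (t - 1) u))\<^sup>2) ` X0)"
    by (rule bdd_aboveI2)
qed

lemma gradient_changes_le_variation:
  assumes "\<And>t. t \<in> I \<Longrightarrow> y t \<in> X0" and "I \<subseteq> {1..T}" and "X0 \<noteq> {}"
  shows "(\<Sum>t\<in>I. (dual_norm d N (df t (y t) - df (t - 1) (y t)))\<^sup>2) \<le> grad_variation d N X0 df T"
proof -
  obtain v where v: "v \<in> X0"
    using assms(3) by blast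
  have nonneg: "0 \<le> (SUP u\<in>X0. (dual_norm d N (df t u - df (t - 1) u))\<^sup>2)" for t
    by (rule order_trans[OF zero_le_power2 gradient_change_le_SUP[OF v]])
  have "(\<Sum>t\<in>I. (dual_norm d N (df t (y t) - df (t - 1) (y t)))\<^sup>2)
      \<le> (\<Sum>t\<in>I. SUP u\<in>X0. (dual_norm d N (df t u - df (t - 1) u))\<^sup>2)"
    by (intro sum_mono gradient_change_le_SUP assms(1))
  also have "\<dots> \<le> grad_variation d N X0 df T"
    unfolding grad_variation_def using assms(2) by (intro sum_mono2 nonneg) auto
  finally show ?thesis .
qed

lemma grad_variation_nonneg: "X0 \<noteq> {} \<Longrightarrow> 0 \<le> grad_variation d N X0 df T"
  using gradient_changes_le_variation[of "{}"] by simp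

lemma slater_constant_le:
  assumes "slater X0 K g \<sigma>"
  shows "\<sigma> \<le> G"
proof -
  obtain u where u: "u \<in> X0" "\<And>k. k \<in> {1..K} \<Longrightarrow> g k u \<le> - \<sigma>"
    using assms by (auto simp: slater_def)
  have "\<sigma> \<le> \<bar>g 1 u\<bar>"
    using u(2)[of 1] K_pos by auto
  also have "\<dots> \<le> (\<Sum>k=1..K. \<bar>g k u\<bar>)"
    using K_pos by (intro member_le_sum) auto
  also have "\<dots> \<le> G"
    by (rule g_bound[OF u(1)])
  finally show ?thesis .
qed

end

context mirror_prox
begin

lemma bregman_telescope:
  assumes u: "u \<in> X0" and s: "1 \<le> s" "s \<le> e" and e: "e \<le> T"
  shows "(\<Sum>t=s..e. \<alpha> t * (D u (xt t) - D u (xt (Suc t)))) \<le> \<alpha> e * R\<^sup>2"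
proof -
  \<comment> \<open>Abel summation: the step parameters increase and each divergence is at most \<open>R\<^sup>2\<close>.\<close>
  have "(\<Sum>t=s..e. \<alpha> t * (D u (xt t) - D u (xt (Suc t)))) \<le> \<alpha> e * (R\<^sup>2 - D u (xt (Suc e)))"
    using s(2) e
  proof (induction e rule: dec_induct)
    case base
    show ?case
      using base s u \<alpha>_nonneg[of s] bregman_le[of u "xt s"] center_in_X0[of s]
      by (auto intro!: mult_left_mono)
  next
    case (step e)
    have "\<alpha> e \<le> \<alpha> (Suc e)"
      using \<alpha>_eq[of "Suc e"] step by simp
    moreover have "0 \<le> R\<^sup>2 - D u (xt (Suc e))"
      using bregman_le[of u "xt (Suc e)"] center_in_X0[of "Suc e"] u step by simp
    ultimately have "\<alpha> e * (R\<^sup>2 - D u (xt (Suc e))) \<le> \<alpha> (Suc e) * (R\<^sup>2 - D u (xt (Suc e)))"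
      by (rule mult_right_mono)
    then show ?case
      using step s by (simp add: algebra_simps)
  qed
  also have "\<dots> \<le> \<alpha> e * R\<^sup>2"
    using \<alpha>_nonneg[OF e] bregman_nonneg[OF u center_in_X0[of "Suc e"]] s e
    by (intro mult_left_mono) auto
  finally show ?thesis .
qed

lemma window_bound:
  assumes u: "u \<in> X0" and s: "1 \<le> s" "s \<le> e" and e: "e \<le> T"
  shows "(\<Sum>t=s..e. f t (x t) - f t u)
      + (\<Sum>k=1..K. (dual (Suc e) k)\<^sup>2) / 2 - (\<Sum>k=1..K. (dual s k)\<^sup>2) / 2
    \<le> \<eta> / 2 * grad_variation d N X0 df T + \<alpha> e * R\<^sup>2 + \<gamma>\<^sup>2 / 2 * G\<^sup>2
      + (\<xi> s + \<eta> * L\<^sub>f\<^sup>2) * (2 * R\<^sup>2 * inverse \<rho>)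
      + \<gamma> * (\<Sum>t=s..e. \<Sum>k=1..K. (dual t k + \<gamma> * g k (x (t - 1))) * g k u)"
proof -
  let ?e = "\<lambda>t. (dual_norm d N (df t (x (t - 1)) - df (t - 1) (x (t - 1))))\<^sup>2"
  let ?A = "\<lambda>t. \<Sum>k=1..K. (dual t k)\<^sup>2" and ?G = "\<lambda>t. \<Sum>k=1..K. (g k (x (t - 1)))\<^sup>2"
  let ?B = "\<lambda>t. (\<xi> t + \<eta> * L\<^sub>f\<^sup>2) * (N (xt t - x (t - 1)))\<^sup>2"
  let ?C = "\<lambda>t. \<Sum>k=1..K. (dual t k + \<gamma> * g k (x (t - 1))) * g k u"
  have "(\<Sum>t=s..e. (f t (x t) - f t u) + (?A (Suc t) - ?A t) / 2)
    \<le> (\<Sum>t=s..e. \<eta> / 2 * ?e t + \<alpha> t * (D u (xt t) - D u (xt (Suc t)))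
        + \<gamma>\<^sup>2 / 2 * (?G (Suc t) - ?G t) - (?B (Suc t) - ?B t) + \<gamma> * ?C t)"
  proof (rule sum_mono)
    fix t assume "t \<in> {s..e}"
    then have "t \<in> {1..T}"
      using s e by auto
    from one_round[OF this u]
    show "(f t (x t) - f t u) + (?A (Suc t) - ?A t) / 2
      \<le> \<eta> / 2 * ?e t + \<alpha> t * (D u (xt t) - D u (xt (Suc t)))
        + \<gamma>\<^sup>2 / 2 * (?G (Suc t) - ?G t) - (?B (Suc t) - ?B t) + \<gamma> * ?C t"
      by (simp del: dual_iterate.simps add: diff_divide_distrib)
  qed
  also have "\<dots> = \<eta> / 2 * (\<Sum>t=s..e. ?e t) + (\<Sum>t=s..e. \<alpha> t * (D u (xt t) - D u (xt (Suc t))))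
      + \<gamma>\<^sup>2 / 2 * (\<Sum>t=s..e. ?G (Suc t) - ?G t) - (\<Sum>t=s..e. ?B (Suc t) - ?B t)
      + \<gamma> * (\<Sum>t=s..e. ?C t)"
    unfolding sum.distrib sum_subtractf[where g = "\<lambda>t. ?B (Suc t) - ?B t"] sum_distrib_left ..
  also have "(\<Sum>t=s..e. (f t (x t) - f t u) + (?A (Suc t) - ?A t) / 2)
    = (\<Sum>t=s..e. f t (x t) - f t u) + (\<Sum>t=s..e. ?A (Suc t) - ?A t) / 2"
    unfolding sum.distrib sum_divide_distrib ..
  also have "(\<Sum>t=s..e. ?A (Suc t) - ?A t) = ?A (Suc e) - ?A s"
    using s by (intro sum_Suc_diff) auto
  also have "(\<Sum>t=s..e. ?B (Suc t) - ?B t) = ?B (Suc e) - ?B s"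
    using s by (intro sum_Suc_diff) auto
  also have "(\<Sum>t=s..e. ?G (Suc t) - ?G t) = ?G (Suc e) - ?G s"
    using s by (intro sum_Suc_diff) auto
  finally have main: "(\<Sum>t=s..e. f t (x t) - f t u) + (?A (Suc e) - ?A s) / 2
    \<le> \<eta> / 2 * (\<Sum>t=s..e. ?e t) + (\<Sum>t=s..e. \<alpha> t * (D u (xt t) - D u (xt (Suc t))))
      + \<gamma>\<^sup>2 / 2 * (?G (Suc e) - ?G s) - (?B (Suc e) - ?B s) + \<gamma> * (\<Sum>t=s..e. ?C t)" .
  have "(\<Sum>t=s..e. ?e t) \<le> grad_variation d N X0 df T"
    using s e u by (intro gradient_changes_le_variation iterate_in_X0) auto
  then have 1: "\<eta> / 2 * (\<Sum>t=s..e. ?e t) \<le> \<eta> / 2 * grad_variation d N X0 df T"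
    using \<eta>_pos by (intro mult_left_mono) auto
  have "(\<Sum>k=1..K. \<bar>g k (x e)\<bar>)\<^sup>2 \<le> G\<^sup>2"
    by (intro power_mono g_bound iterate_in_X0 e sum_nonneg) auto
  then have "?G (Suc e) \<le> G\<^sup>2"
    using sum_square_le_square_sum[of "{1..K}" "\<lambda>k. \<bar>g k (x e)\<bar>"] by simp
  moreover have "0 \<le> ?G s"
    by (intro sum_nonneg) auto
  ultimately have "?G (Suc e) - ?G s \<le> G\<^sup>2"
    by linarith
  then have 2: "\<gamma>\<^sup>2 / 2 * (?G (Suc e) - ?G s) \<le> \<gamma>\<^sup>2 / 2 * G\<^sup>2"
    by (intro mult_left_mono) auto
  have 3: "?B s \<le> (\<xi> s + \<eta> * L\<^sub>f\<^sup>2) * (2 * R\<^sup>2 * inverse \<rho>)"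
    using s e \<xi>_nonneg[of s] \<eta>_pos
    by (intro mult_left_mono N_square_le center_in_X0 iterate_in_X0) auto
  have 4: "0 \<le> ?B (Suc e)"
    using \<xi>_nonneg[of "Suc e"] \<eta>_pos by simp
  show ?thesis
    using main 1 2 3 4 bregman_telescope[OF u s e] by (simp only: diff_divide_distrib)
qed

lemma \<alpha>_upper:
  assumes "\<And>t. t \<in> {1..T} \<Longrightarrow> \<xi> t \<le> B" and "0 \<le> B" and "t \<le> T"
  shows "\<alpha> t \<le> 2 * inverse \<rho> * (\<gamma>\<^sup>2 * L\<^sub>g * G + \<eta> * L\<^sub>f\<^sup>2 + inverse \<eta> + B)"
  using assms(3)
proof (induction t)
  case 0
  show ?case
    using \<rho>_pos \<eta>_pos Lg_nonneg G_nonneg assms(2) by (simp add: \<alpha>_0)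
next
  case (Suc t)
  have "2 * inverse \<rho> * (\<gamma>\<^sup>2 * L\<^sub>g * G + \<eta> * L\<^sub>f\<^sup>2 + inverse \<eta> + \<xi> (Suc t))
      \<le> 2 * inverse \<rho> * (\<gamma>\<^sup>2 * L\<^sub>g * G + \<eta> * L\<^sub>f\<^sup>2 + inverse \<eta> + B)"
    using assms(1)[of "Suc t"] Suc \<rho>_pos by (intro mult_left_mono) auto
  then show ?case
    using Suc \<alpha>_eq[of "Suc t"] by simp
qed

lemma loss_difference_lower:
  assumes "u \<in> X0" "t \<le> T"
  shows "- (F * (1 + 2 * R\<^sup>2 * inverse \<rho>)) \<le> f t (x t) - f t u"
proof -
  have x: "x t \<in> X0"
    by (rule iterate_in_X0[OF assms(2)])
  have "f t u + df t u \<bullet> (x t - u) \<le> f t (x t)"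
    by (rule convex_on_gradient_bound[OF f_gradient X0_convex f_convex x assms(1)])
  moreover have "df t u \<bullet> (u - x t) \<le> F * (1 + 2 * R\<^sup>2 * inverse \<rho>)"
  proof -
    have "df t u \<bullet> (u - x t) \<le> dual_norm d N (df t u) * N (u - x t)"
      by (intro inner_le_dual_norm[OF norm_N] X0_diff_in_Rd assms x)
    also have "\<dots> \<le> F * N (u - x t)"
      by (intro mult_right_mono df_bound N_nonneg assms x)
    also have "\<dots> \<le> F * (1 + 2 * R\<^sup>2 * inverse \<rho>)"
    proof (rule mult_left_mono[OF _ F_nonneg])
      \<comment> \<open>A square root of \<open>N_square_le\<close> would not be polynomial in the constants.\<close>
      have "N (u - x t) \<le> 1 + (N (u - x t))\<^sup>2"
        using zero_le_power2[of "N (u - x t) - 1"] N_nonneg[OF assms(1) x]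
        by (simp add: power2_eq_square algebra_simps)
      then show "N (u - x t) \<le> 1 + 2 * R\<^sup>2 * inverse \<rho>"
        using N_square_le[OF assms(1) x] by simp
    qed
    finally show ?thesis .
  qed
  ultimately show ?thesis
    by (simp add: inner_diff_right)
qed

lemma dual_l1_growth:
  "s + j \<le> Suc T \<Longrightarrow> dual_l1 K (dual (s + j)) \<le> dual_l1 K (dual s) + real j * (\<gamma> * G)"
proof (induction j)
  case (Suc j)
  then show ?case
    using dual_l1_Suc[of "s + j"] by (simp add: distrib_right del: dual_iterate.simps)
qed simp

text \<open>
  The potential is Euclidean, whereas the step parameters depend on the \<open>l1\<close>-norm of the dual
  iterate; the number of constraints is the price for passing from one to the other.
\<close>

lemma dual_l1_le_max:
  assumes "(\<Sum>k=1..K. (dual t k)\<^sup>2) \<le> (\<Sum>k=1..K. (dual s k)\<^sup>2)"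
  shows "dual_l1 K (dual t) \<le> real K * dual_l1 K (dual s)"
proof (rule power2_le_imp_le)
  have "(dual_l1 K (dual t))\<^sup>2 \<le> real K * (\<Sum>k=1..K. (dual t k)\<^sup>2)"
    using sum_squared_le_sum_of_squares[of "dual t" "{1..K}"]
    by (simp add: dual_l1_dual_iterate mult.commute)
  also have "\<dots> \<le> real K * (\<Sum>k=1..K. (dual s k)\<^sup>2)"
    using assms by (intro mult_left_mono) auto
  also have "\<dots> \<le> real K * (dual_l1 K (dual s))\<^sup>2"
    unfolding dual_l1_dual_iterate
    by (intro mult_left_mono sum_square_le_square_sum dual_iterate_nonneg) auto
  also have "\<dots> \<le> (real K)\<^sup>2 * (dual_l1 K (dual s))\<^sup>2"
    using K_pos by (intro mult_right_mono) (auto simp: power2_eq_square)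
  finally show "(dual_l1 K (dual t))\<^sup>2 \<le> (real K * dual_l1 K (dual s))\<^sup>2"
    by (simp add: power_mult_distrib)
qed (simp add: dual_l1_nonneg)

lemma multiplier_sum_lower:
  assumes "t \<in> {1..T}"
  shows "dual_l1 K (dual t) - \<gamma> * G \<le> (\<Sum>k=1..K. dual t k + \<gamma> * g k (x (t - 1)))"
proof -
  have "- (\<Sum>k=1..K. g k (x (t - 1))) \<le> (\<Sum>k=1..K. \<bar>g k (x (t - 1))\<bar>)"
    by (subst sum_negf[symmetric]) (intro sum_mono, simp)
  also have "\<dots> \<le> G"
    using assms by (intro g_bound iterate_in_X0) auto
  finally have "- (\<Sum>k=1..K. g k (x (t - 1))) \<le> G" .
  then have "\<gamma> * - (\<Sum>k=1..K. g k (x (t - 1))) \<le> \<gamma> * G"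
    using \<gamma>_pos by (intro mult_left_mono) auto
  then show ?thesis
    by (simp add: sum.distrib sum_distrib_left dual_l1_dual_iterate)
qed

lemma multiplier_nonneg: "1 \<le> t \<Longrightarrow> 0 \<le> dual t k + \<gamma> * g k (x (t - 1))"
  using dual_iterate_shift_nonneg[of g \<gamma> x "t - 1" k] by (simp del: dual_iterate.simps)

end

section \<open>Slater's condition bounds the dual iterates\<close>

text \<open>
  The constants are functions of real arguments, with \<open>k\<close> for the number of constraints and \<open>r\<close> for
  \<open>1 / \<rho>\<close>, so that they can be read as polynomials.  The factor \<open>2 * R\<^sup>2 * r\<close> is the bound on the
  squared \<open>N\<close>-diameter of \<open>X0\<close>.
\<close>

definition dual_const :: "real \<Rightarrow> real \<Rightarrow> real \<Rightarrow> real \<Rightarrow> real \<Rightarrow> real \<Rightarrow> real \<Rightarrow> real" where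
  "dual_const R H F G L k r =
     (2 * (2 * R\<^sup>2 * r) * L * k + 1 + 1) * (F * (1 + 2 * R\<^sup>2 * r))
     + (1 / 2 + 1 / 2 * G\<^sup>2 + 2 * R\<^sup>2 * r * (3 * (L * G) + 2 * H\<^sup>2 + 3))
     + (2 * (2 * R\<^sup>2 * r) * L * k + 1 + G) * (2 * (2 * R\<^sup>2 * r) * L * k + 1 + 2) * G"

definition regret_const :: "real \<Rightarrow> real \<Rightarrow> real \<Rightarrow> real \<Rightarrow> real \<Rightarrow> real \<Rightarrow> real \<Rightarrow> real" where
  "regret_const R H F G L k r =
     G\<^sup>2 + 1 + 2 * (2 * R\<^sup>2 * r) * (2 * (L * G) + 2 + H\<^sup>2 + L * (k * dual_const R H F G L k r))"

text \<open>
  For \<open>w = sqrt (V + L\<^sub>f\<^sup>2 + 1)\<close> this is the tuning of the theorem.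
\<close>

locale tuned_mirror_prox =
  mirror_prox d N X0 f df K g dg F L\<^sub>f G Hk L\<^sub>g \<omega> d\<omega> \<rho> H R \<gamma> \<eta> \<alpha> T x xt Q
  for d N X0 f df K g dg F L\<^sub>f G Hk L\<^sub>g \<omega> d\<omega> \<rho> H R \<gamma> \<eta> \<alpha> T x xt Q +
  fixes w :: real
  assumes w_ge_1: "1 \<le> w" and \<gamma>_sq: "\<gamma>\<^sup>2 = w" and \<eta>_eq: "\<eta> = inverse w"
    and w_sq: "grad_variation d N X0 df T + L\<^sub>f\<^sup>2 \<le> w\<^sup>2"
begin

abbreviation "r \<equiv> inverse \<rho>"

lemma X0_nonempty: "X0 \<noteq> {}"
  using iterate_in_X0[of 0] by auto

lemma \<eta>_variation: "\<eta> * grad_variation d N X0 df T \<le> w"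
  and \<eta>_smooth: "\<eta> * L\<^sub>f\<^sup>2 \<le> w"
proof -
  have le: "inverse w * a \<le> w" if "a \<le> w\<^sup>2" for a
    using that w_ge_1 by (simp add: field_simps power2_eq_square)
  show "\<eta> * grad_variation d N X0 df T \<le> w"
    unfolding \<eta>_eq by (rule le) (use w_sq zero_le_power2[of "L\<^sub>f"] in linarith)
  show "\<eta> * L\<^sub>f\<^sup>2 \<le> w"
    unfolding \<eta>_eq by (rule le) (use w_sq grad_variation_nonneg[OF X0_nonempty, of T] in linarith)
qed

lemma sq_diam_nonneg: "0 \<le> 2 * R\<^sup>2 * r"
  using \<rho>_pos by simp

lemma tuned_window_bound:
  assumes u: "u \<in> X0" and s: "1 \<le> s" "s \<le> e" and e: "e \<le> T"
    and B: "\<And>t. t \<in> {1..T} \<Longrightarrow> \<gamma> * dual_l1 K (dual t) \<le> B" "0 \<le> B"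
  shows "(\<Sum>t=s..e. f t (x t) - f t u)
      + (\<Sum>k=1..K. (dual (Suc e) k)\<^sup>2) / 2 - (\<Sum>k=1..K. (dual s k)\<^sup>2) / 2
    \<le> w * (1 / 2 + 1 / 2 * G\<^sup>2 + 2 * R\<^sup>2 * r * (3 * (L\<^sub>g * G) + 2 * H\<^sup>2 + 3))
      + 2 * (2 * R\<^sup>2 * r) * L\<^sub>g * B
      + \<gamma> * (\<Sum>t=s..e. \<Sum>k=1..K. (dual t k + \<gamma> * g k (x (t - 1))) * g k u)"
proof -
  let ?D = "2 * R\<^sup>2 * r" and ?X = "L\<^sub>g * B + w * (L\<^sub>g * G + H\<^sup>2)"
  have \<xi>: "\<xi> t \<le> ?X" if "t \<in> {1..T}" for t
    using mult_left_mono[OF B(1)[OF that] Lg_nonneg] by (simp add: \<xi>_def \<gamma>_sq mult_ac)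
  have X: "0 \<le> ?X"
    using B(2) Lg_nonneg G_nonneg w_ge_1 by simp
  have "\<alpha> e \<le> 2 * r * (\<gamma>\<^sup>2 * L\<^sub>g * G + \<eta> * L\<^sub>f\<^sup>2 + inverse \<eta> + ?X)"
    by (rule \<alpha>_upper[OF \<xi> X e])
  also have "\<dots> \<le> 2 * r * (w * (L\<^sub>g * G) + w + w + ?X)"
    using \<eta>_smooth \<rho>_pos by (intro mult_left_mono) (auto simp: \<gamma>_sq \<eta>_eq)
  finally have "\<alpha> e * R\<^sup>2 \<le> 2 * r * (w * (L\<^sub>g * G) + w + w + ?X) * R\<^sup>2"
    by (rule mult_right_mono) simp
  then have 1: "\<alpha> e * R\<^sup>2 \<le> ?D * (w * (L\<^sub>g * G) + w + w + ?X)"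
    by (simp only: mult_ac)
  have "\<xi> s + \<eta> * L\<^sub>f\<^sup>2 \<le> ?X + w"
    using \<xi>[of s] s e \<eta>_smooth by auto
  then have 2: "(\<xi> s + \<eta> * L\<^sub>f\<^sup>2) * ?D \<le> (?X + w) * ?D"
    by (rule mult_right_mono[OF _ sq_diam_nonneg])
  have 3: "\<eta> / 2 * grad_variation d N X0 df T \<le> w / 2"
    using \<eta>_variation by simp
  have "w / 2 + ?D * (w * (L\<^sub>g * G) + w + w + ?X) + w / 2 * G\<^sup>2 + (?X + w) * ?D
    = w * (1 / 2 + 1 / 2 * G\<^sup>2 + ?D * (3 * (L\<^sub>g * G) + 2 * H\<^sup>2 + 3)) + 2 * ?D * L\<^sub>g * B"
    by (simp add: algebra_simps)
  then show ?thesis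
    using window_bound[OF u s e] 1 2 3 unfolding \<gamma>_sq by linarith
qed

lemma dual_const_nonneg: "0 \<le> dual_const R H F G L\<^sub>g (real K) r"
  unfolding dual_const_def
  using F_nonneg G_nonneg Lg_nonneg \<rho>_pos by (intro add_nonneg_nonneg mult_nonneg_nonneg) auto

text \<open>
  Let \<open>\<tau>\<close> be a round with the largest dual iterate.  Over the \<open>S\<close> rounds before \<open>\<tau>\<close> the drift is
  nonnegative, while the Slater point contributes about \<open>- \<gamma> \<sigma> S \<parallel>Q(\<tau>)\<parallel>\<^sub>1\<close>, because the
  dual iterates change slowly.  On the other side they enter only through \<open>L\<^sub>g \<gamma> \<parallel>Q\<parallel>\<^sub>1\<close>, with a
  factor independent of \<open>S\<close>; this is outweighed as soon as \<open>\<sigma> S\<close> exceeds that factor.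
  Single rounds would not do: the divergence terms are bounded only after they are summed.
\<close>

lemma dual_iterate_bound:
  assumes slater: "slater X0 K g \<sigma>" and t: "t \<in> {1..T}"
  shows "\<gamma> * dual_l1 K (dual t)
    \<le> w * (1 + inverse \<sigma>) * (real K * dual_const R H F G L\<^sub>g (real K) r)"
proof -
  let ?D = "2 * R\<^sup>2 * r"
  \<comment> \<open>\<open>A - 1\<close> is the factor with which \<open>\<gamma> \<parallel>Q(\<tau>)\<parallel>\<^sub>1\<close> enters \<open>tuned_window_bound\<close>.\<close>
  define A where "A = 2 * ?D * L\<^sub>g * real K + 1"
  define C where "C = 1 / 2 + 1 / 2 * G\<^sup>2 + ?D * (3 * (L\<^sub>g * G) + 2 * H\<^sup>2 + 3)"
  define i where "i = inverse \<sigma>"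
  have \<sigma>: "0 < \<sigma>" "\<sigma> \<le> G"
    using slater slater_constant_le[OF slater] by (auto simp: slater_def)
  have i: "0 < i"
    using \<sigma> by (simp add: i_def)
  obtain u where u: "u \<in> X0" "\<And>k. k \<in> {1..K} \<Longrightarrow> g k u \<le> - \<sigma>"
    using slater by (auto simp: slater_def)
  have A: "1 \<le> A"
    unfolding A_def using sq_diam_nonneg Lg_nonneg by (simp del: mult_2_right)
  have C: "0 \<le> C"
    unfolding C_def using \<rho>_pos Lg_nonneg G_nonneg
    by (intro add_nonneg_nonneg mult_nonneg_nonneg) auto
  define S where "S = nat \<lceil>A / \<sigma>\<rceil>"
  have "0 < A / \<sigma>"
    using A \<sigma> by simp
  then have S: "A / \<sigma> \<le> real S" "real S \<le> A / \<sigma> + 1"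
    unfolding S_def by (auto simp: of_nat_nat)
  have S_pos: "0 < S"
    using S(1) \<open>0 < A / \<sigma>\<close> by (cases S) auto
  have \<sigma>S: "A \<le> \<sigma> * real S" "\<sigma> * real S \<le> A + G"
    using S \<sigma> by (simp_all add: field_simps)
  have S_le: "real S \<le> (A + 1) * (1 + i)" "real S + 1 \<le> (A + 2) * (1 + i)"
  proof -
    have "real S \<le> A * i + 1"
      using S(2) by (simp add: i_def divide_inverse)
    moreover have "0 \<le> i" "0 \<le> A"
      using i A by auto
    ultimately show "real S \<le> (A + 1) * (1 + i)" "real S + 1 \<le> (A + 2) * (1 + i)"
      by (auto simp: algebra_simps)
  qed
  let ?sq = "\<lambda>t. \<Sum>k=1..K. (dual t k)\<^sup>2"
  have "Max (?sq ` {1..T}) \<in> ?sq ` {1..T}"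
    using t by (intro Max_in) auto
  then obtain \<tau> where \<tau>: "\<tau> \<in> {1..T}" "?sq \<tau> = Max (?sq ` {1..T})"
    by auto
  have sq_max: "?sq s \<le> ?sq \<tau>" if "s \<in> {1..T}" for s
    unfolding \<tau>(2) using that by (intro Max_ge) auto
  define m where "m = dual_l1 K (dual \<tau>)"
  have m: "0 \<le> \<gamma> * m"
    using \<gamma>_pos by (simp add: m_def dual_l1_nonneg)
  have le_m: "\<gamma> * dual_l1 K (dual s) \<le> real K * (\<gamma> * m)" if "s \<in> {1..T}" for s
    using mult_left_mono[OF dual_l1_le_max[OF sq_max[OF that]], of \<gamma>] \<gamma>_pos
    by (simp add: m_def mult.left_commute)
  have growth: "m - real j * (\<gamma> * G) \<le> dual_l1 K (dual (\<tau> - j))" if "j \<le> \<tau>" for j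
    using dual_l1_growth[of "\<tau> - j" j] that \<tau>(1) by (simp add: m_def)
  have bound: "\<gamma> * m \<le> w * ((A + G) * (real S + 1) * G) + real S * (F * (1 + ?D)) + w * C"
  proof (cases "\<tau> \<le> S")
    \<comment> \<open>Too early for a full window, but then the dual variables have not had the time to grow.\<close>
    case True
    have "m \<le> real \<tau> * (\<gamma> * G)"
      using growth[of \<tau>] by (simp add: dual_l1_def)
    also have "\<dots> \<le> real S * (\<gamma> * G)"
      using True \<gamma>_pos G_nonneg by (intro mult_right_mono) auto
    finally have "\<gamma> * m \<le> \<gamma> * (real S * (\<gamma> * G))"
      using \<gamma>_pos by (intro mult_left_mono) auto
    also have "\<dots> = w * (real S * G)"
      by (simp add: \<gamma>_sq[symmetric] power2_eq_square)
    also have "\<dots> \<le> w * ((A + G) * (real S + 1) * G)"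
    proof -
      have "1 * real S \<le> (A + G) * (real S + 1)"
        using A G_nonneg by (intro mult_mono) auto
      then show ?thesis
        using w_ge_1 G_nonneg by (intro mult_left_mono mult_right_mono) auto
    qed
    also have "\<dots> \<le> w * ((A + G) * (real S + 1) * G) + real S * (F * (1 + ?D)) + w * C"
      using F_nonneg sq_diam_nonneg C w_ge_1 by simp
    finally show ?thesis .
  next
    case False
    define s e where "s = \<tau> - S" and "e = \<tau> - 1"
    have se: "1 \<le> s" "s \<le> e" "e \<le> T" "Suc e = \<tau>" "card {s..e} = S" "s \<in> {1..T}"
      using False S_pos \<tau>(1) by (auto simp: s_def e_def)
    have gain: "(\<Sum>k=1..K. (dual t k + \<gamma> * g k (x (t - 1))) * g k u) \<le> - \<sigma> * (m - (real S + 1) * (\<gamma> * G))"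
      if "t \<in> {s..e}" for t
    proof -
      have t: "t \<in> {1..T}" "t = \<tau> - (\<tau> - t)" "\<tau> - t \<le> S"
        using that se by (auto simp: s_def e_def)
      have "(\<Sum>k=1..K. (dual t k + \<gamma> * g k (x (t - 1))) * g k u)
          \<le> (\<Sum>k=1..K. (dual t k + \<gamma> * g k (x (t - 1))) * - \<sigma>)"
        using t by (intro sum_mono mult_left_mono u multiplier_nonneg) auto
      also have "\<dots> = - \<sigma> * (\<Sum>k=1..K. dual t k + \<gamma> * g k (x (t - 1)))"
        by (simp add: sum_distrib_left mult.commute)
      also have "\<dots> \<le> - \<sigma> * (m - (real S + 1) * (\<gamma> * G))"
      proof (rule mult_left_mono_neg)
        have "m - real (\<tau> - t) * (\<gamma> * G) \<le> dual_l1 K (dual t)"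
          using growth[of "\<tau> - t"] t(2) by simp
        moreover have "real (\<tau> - t) * (\<gamma> * G) \<le> real S * (\<gamma> * G)"
          using t(3) \<gamma>_pos G_nonneg by (intro mult_right_mono) auto
        ultimately show "m - (real S + 1) * (\<gamma> * G) \<le> (\<Sum>k=1..K. dual t k + \<gamma> * g k (x (t - 1)))"
          using multiplier_sum_lower[OF t(1)] by (simp add: distrib_right)
      qed (use \<sigma> in simp)
      finally show ?thesis .
    qed
    have "(\<Sum>t=s..e. \<Sum>k=1..K. (dual t k + \<gamma> * g k (x (t - 1))) * g k u)
        \<le> real S * (- \<sigma> * (m - (real S + 1) * (\<gamma> * G)))"
      unfolding se(5)[symmetric] by (rule sum_bounded_above) (rule gain[unfolded se(5)[symmetric]])
    then have "\<gamma> * (\<Sum>t=s..e. \<Sum>k=1..K. (dual t k + \<gamma> * g k (x (t - 1))) * g k u)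
        \<le> \<gamma> * (real S * (- \<sigma> * (m - (real S + 1) * (\<gamma> * G))))"
      using \<gamma>_pos by (intro mult_left_mono) auto
    also have "\<dots> = w * ((\<sigma> * real S) * (real S + 1) * G) - (\<sigma> * real S) * (\<gamma> * m)"
      by (simp add: \<gamma>_sq[symmetric] power2_eq_square algebra_simps)
    finally have slater_gain: "\<gamma> * (\<Sum>t=s..e. \<Sum>k=1..K. (dual t k + \<gamma> * g k (x (t - 1))) * g k u)
        \<le> w * ((\<sigma> * real S) * (real S + 1) * G) - (\<sigma> * real S) * (\<gamma> * m)" .
    have "real (card {s..e}) * - (F * (1 + ?D)) \<le> (\<Sum>t=s..e. f t (x t) - f t u)"
      by (rule sum_bounded_below) (use se in \<open>auto intro!: loss_difference_lower u\<close>)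
    then have loss: "- (real S * (F * (1 + ?D))) \<le> (\<Sum>t=s..e. f t (x t) - f t u)"
      unfolding se(5) by simp
    have "0 \<le> ?sq (Suc e) / 2 - ?sq s / 2"
      using sq_max[OF se(6)] by (simp only: se(4))
    moreover have "(\<Sum>t=s..e. f t (x t) - f t u) + ?sq (Suc e) / 2 - ?sq s / 2
      \<le> w * C + 2 * ?D * L\<^sub>g * (real K * (\<gamma> * m))
        + \<gamma> * (\<Sum>t=s..e. \<Sum>k=1..K. (dual t k + \<gamma> * g k (x (t - 1))) * g k u)"
      unfolding C_def using m by (intro tuned_window_bound u se le_m) auto
    moreover have "2 * ?D * L\<^sub>g * (real K * (\<gamma> * m)) = (A - 1) * (\<gamma> * m)"
      by (simp add: A_def)
    ultimately have "(\<sigma> * real S - (A - 1)) * (\<gamma> * m)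
      \<le> w * ((\<sigma> * real S) * (real S + 1) * G) + real S * (F * (1 + ?D)) + w * C"
      using slater_gain loss by (simp add: left_diff_distrib)
    moreover have "1 * (\<gamma> * m) \<le> (\<sigma> * real S - (A - 1)) * (\<gamma> * m)"
      using \<sigma>S(1) by (intro mult_right_mono m) auto
    moreover have "w * ((\<sigma> * real S) * (real S + 1) * G) \<le> w * ((A + G) * (real S + 1) * G)"
      using \<sigma>S(2) w_ge_1 G_nonneg by (intro mult_left_mono mult_right_mono) auto
    ultimately show ?thesis
      by linarith
  qed
  have "(A + G) * (real S + 1) * G \<le> (A + G) * ((A + 2) * (1 + i)) * G"
    using S_le(2) A G_nonneg by (intro mult_right_mono mult_left_mono) auto
  then have 1: "w * ((A + G) * (real S + 1) * G) \<le> w * ((A + G) * ((A + 2) * (1 + i)) * G)"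
    using w_ge_1 by (intro mult_left_mono) auto
  have "0 \<le> (A + 1) * (1 + i)"
    using A i by simp
  then have "real S \<le> w * ((A + 1) * (1 + i))"
    using S_le(1) mult_right_mono[OF w_ge_1, of "(A + 1) * (1 + i)"] by linarith
  then have 2: "real S * (F * (1 + ?D)) \<le> w * ((A + 1) * (1 + i)) * (F * (1 + ?D))"
    using F_nonneg sq_diam_nonneg by (intro mult_right_mono) auto
  have 3: "w * C \<le> w * ((1 + i) * C)"
    using w_ge_1 C i by (intro mult_left_mono) (auto simp: distrib_right)
  have const: "dual_const R H F G L\<^sub>g (real K) r
      = (A + 1) * (F * (1 + ?D)) + C + (A + G) * (A + 2) * G"
    by (simp add: dual_const_def A_def C_def)
  have "w * (1 + i) * dual_const R H F G L\<^sub>g (real K) r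
      = w * ((A + G) * ((A + 2) * (1 + i)) * G) + w * ((A + 1) * (1 + i)) * (F * (1 + ?D)) + w * ((1 + i) * C)"
    unfolding const by (simp only: algebra_simps)
  then have "\<gamma> * m \<le> w * (1 + i) * dual_const R H F G L\<^sub>g (real K) r"
    using bound 1 2 3 by linarith
  then have "real K * (\<gamma> * m) \<le> real K * (w * (1 + i) * dual_const R H F G L\<^sub>g (real K) r)"
    by (intro mult_left_mono) auto
  then show ?thesis
    using le_m[OF t] by (simp add: i_def mult_ac)
qed

section \<open>The regret bound\<close>

text \<open>
  A feasible comparator makes the constraint term nonpositive, and \<open>Q\<^sub>k(1) = \<gamma> \<bar>g\<^sub>k(x\<^sub>0)\<bar>\<close> bounds the
  initial potential; the dual bound takes care of the \<open>\<parallel>Q\<parallel>\<^sub>1\<close> in \<open>\<alpha>\<^sub>T\<close> and \<open>\<xi>\<^sub>1\<close>.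
\<close>

lemma regret_bound:
  assumes slater: "slater X0 K g \<sigma>" and T: "1 \<le> T" and u: "u \<in> feasible_set X0 K g"
  shows "regret f x u T \<le> regret_const R H F G L\<^sub>g (real K) r * ((1 + inverse \<sigma>) * w)"
    and regret_const_nonneg: "0 \<le> regret_const R H F G L\<^sub>g (real K) r"
proof -
  let ?D = "2 * R\<^sup>2 * r" and ?E = "real K * dual_const R H F G L\<^sub>g (real K) r"
  define i where "i = inverse \<sigma>"
  have i: "0 < i"
    using slater by (simp add: i_def slater_def)
  have E: "0 \<le> ?E"
    using dual_const_nonneg by simp
  have uX: "u \<in> X0"
    using u by (simp add: feasible_set_def)
  have "(\<Sum>t=1..T. f t (x t) - f t u)
      + (\<Sum>k=1..K. (dual (Suc T) k)\<^sup>2) / 2 - (\<Sum>k=1..K. (dual 1 k)\<^sup>2) / 2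
    \<le> w * (1 / 2 + 1 / 2 * G\<^sup>2 + ?D * (3 * (L\<^sub>g * G) + 2 * H\<^sup>2 + 3))
      + 2 * ?D * L\<^sub>g * (w * (1 + i) * ?E)
      + \<gamma> * (\<Sum>t=1..T. \<Sum>k=1..K. (dual t k + \<gamma> * g k (x (t - 1))) * g k u)"
  proof (rule tuned_window_bound[OF uX])
    show "0 \<le> w * (1 + i) * ?E"
      using i w_ge_1 E by simp
  qed (use T dual_iterate_bound[OF slater] in \<open>auto simp: i_def\<close>)
  moreover have "(\<Sum>t=1..T. \<Sum>k=1..K. (dual t k + \<gamma> * g k (x (t - 1))) * g k u) \<le> 0"
    using u by (intro sum_nonpos mult_nonneg_nonpos multiplier_nonneg) (auto simp: feasible_set_def)
  then have "\<gamma> * (\<Sum>t=1..T. \<Sum>k=1..K. (dual t k + \<gamma> * g k (x (t - 1))) * g k u) \<le> 0"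
    using \<gamma>_pos by (intro mult_nonneg_nonpos) auto
  moreover have "0 \<le> (\<Sum>k=1..K. (dual (Suc T) k)\<^sup>2)"
    by (intro sum_nonneg) auto
  moreover have "(\<Sum>k=1..K. (dual 1 k)\<^sup>2) \<le> w * G\<^sup>2"
  proof -
    have "(\<Sum>k=1..K. (dual 1 k)\<^sup>2) \<le> (dual_l1 K (dual 1))\<^sup>2"
      unfolding dual_l1_dual_iterate by (intro sum_square_le_square_sum dual_iterate_nonneg)
    also have "\<dots> \<le> (\<gamma> * G)\<^sup>2"
      using dual_l1_Suc[of 0] by (intro power_mono dual_l1_nonneg) (simp add: dual_l1_def)
    finally show ?thesis
      by (simp add: power_mult_distrib \<gamma>_sq)
  qed
  moreover have "regret f x u T = (\<Sum>t=1..T. f t (x t) - f t u)"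
    by (simp add: regret_def sum_subtractf)
  ultimately have reg: "regret f x u T
    \<le> w * (1 / 2 + G\<^sup>2 + ?D * (3 * (L\<^sub>g * G) + 2 * H\<^sup>2 + 3)) + 2 * ?D * L\<^sub>g * (w * (1 + i) * ?E)"
    by (simp add: distrib_left)
  let ?M = "G\<^sup>2 + 1 + 2 * ?D * (2 * (L\<^sub>g * G) + 2 + H\<^sup>2)"
  have const: "regret_const R H F G L\<^sub>g (real K) r = ?M + 2 * ?D * L\<^sub>g * ?E"
    by (simp add: regret_const_def algebra_simps)
  have LG: "0 \<le> L\<^sub>g * G"
    using Lg_nonneg G_nonneg by simp
  have "?D * (3 * (L\<^sub>g * G) + 2 * H\<^sup>2 + 3) \<le> ?D * (2 * (2 * (L\<^sub>g * G) + 2 + H\<^sup>2))"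
    using LG by (intro mult_left_mono[OF _ sq_diam_nonneg]) (simp add: algebra_simps)
  also have "\<dots> = 2 * ?D * (2 * (L\<^sub>g * G) + 2 + H\<^sup>2)"
    by simp
  finally have "1 / 2 + G\<^sup>2 + ?D * (3 * (L\<^sub>g * G) + 2 * H\<^sup>2 + 3) \<le> ?M"
    by linarith
  also have "0 \<le> ?M"
    using \<rho>_pos Lg_nonneg G_nonneg by (intro add_nonneg_nonneg mult_nonneg_nonneg) auto
  then have "?M \<le> (1 + i) * ?M"
    using i by (simp add: distrib_right)
  finally have "w * (1 / 2 + G\<^sup>2 + ?D * (3 * (L\<^sub>g * G) + 2 * H\<^sup>2 + 3)) \<le> w * ((1 + i) * ?M)"
    using w_ge_1 by (intro mult_left_mono) auto
  moreover have "regret_const R H F G L\<^sub>g (real K) r * ((1 + i) * w)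
      = w * ((1 + i) * ?M) + 2 * ?D * L\<^sub>g * (w * (1 + i) * ?E)"
    unfolding const by (simp only: algebra_simps)
  ultimately show "regret f x u T \<le> regret_const R H F G L\<^sub>g (real K) r * ((1 + inverse \<sigma>) * w)"
    using reg unfolding i_def by linarith
  have "0 \<le> 2 * ?D * L\<^sub>g * ?E"
    by (rule mult_nonneg_nonneg[OF mult_nonneg_nonneg[OF _ Lg_nonneg] E]) (use sq_diam_nonneg in simp)
  then show "0 \<le> regret_const R H F G L\<^sub>g (real K) r"
    using \<open>0 \<le> ?M\<close> const by linarith
qed

end

lemma real_polynomial_function_regret_const:
  assumes "real_polynomial_function R" "real_polynomial_function H" "real_polynomial_function F"
    "real_polynomial_function G" "real_polynomial_function L" "real_polynomial_function k"
    "real_polynomial_function r"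
  shows "real_polynomial_function
    (\<lambda>p. regret_const (R p) (H p) (F p) (G p) (L p) (k p) (r p))"
  unfolding regret_const_def dual_const_def power2_eq_square
  using assms by (intro real_polynomial_function.intros(2-4))

lemma powr_tuning:
  fixes W :: real
  assumes "1 \<le> W"
  shows "(W powr (1 / 4))\<^sup>2 = sqrt W" and "W powr (- 1 / 2) = inverse (sqrt W)"
proof -
  have "- 1 / 2 = - (1 / 2 :: real)"
    by simp
  then show "W powr (- 1 / 2) = inverse (sqrt W)"
    using assms by (simp only: powr_minus powr_half_sqrt)
qed (use assms in \<open>simp add: power2_eq_square powr_add[symmetric] powr_half_sqrt\<close>)

theorem theorem4p2:
  shows "\<exists>P :: real \<times> real \<times> real \<times> real \<times> real \<times> real \<times> real \<times> real \<Rightarrow> real.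
    real_polynomial_function P \<and>
    (\<forall>c>0. \<exists>P' :: real \<times> real \<times> real \<times> real \<times> real \<times> real \<times> real \<times> real \<times> real \<Rightarrow> real.
      real_polynomial_function P' \<and>
      (\<forall>d N X0 f df K g dg F L\<^sub>f G Hk L\<^sub>g \<omega> d\<omega> \<rho> R \<sigma> T H V \<eta> \<gamma> \<xi> \<alpha> x xt Q xs.
        constrained_oco d N X0 f df K g dg F L\<^sub>f G Hk L\<^sub>g \<longrightarrow>
        H = (\<Sum>k=1..K. Hk k) \<longrightarrow>
        slater X0 K g \<sigma> \<longrightarrow>
        distance_generating d N X0 \<omega> d\<omega> \<rho> \<longrightarrow>
        0 < R \<longrightarrow> (\<forall>u\<in>X0. \<forall>v\<in>X0. bregman \<omega> d\<omega> u v \<le> R\<^sup>2) \<longrightarrow>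
        1 \<le> T \<longrightarrow>
        V = grad_variation d N X0 df T \<longrightarrow>
        \<eta> = (V + L\<^sub>f\<^sup>2 + 1) powr (- 1 / 2) \<longrightarrow>
        \<gamma> = (V + L\<^sub>f\<^sup>2 + 1) powr (1 / 4) \<longrightarrow>
        (\<forall>t\<in>{1..T}. \<xi> t = \<gamma> * L\<^sub>g * dual_l1 K (Q t) + \<gamma>\<^sup>2 * (L\<^sub>g * G + H\<^sup>2)) \<longrightarrow>
        \<alpha> 0 = 0 \<longrightarrow>
        (\<forall>t\<in>{1..T}. \<alpha> t =
           max (2 * inverse \<rho> * (\<gamma>\<^sup>2 * L\<^sub>g * G + \<eta> * L\<^sub>f\<^sup>2 + inverse \<eta> + \<xi> t)) (\<alpha> (t - 1))) \<longrightarrow>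
        mirror_prox_run X0 df K g dg \<omega> d\<omega> \<gamma> \<alpha> T x xt Q \<longrightarrow>
        is_arg_min (\<lambda>u. \<Sum>t=1..T. f t u) (\<lambda>u. u \<in> feasible_set X0 K g) xs \<longrightarrow>
        regret f x xs T
          \<le> P (R, H, F, G, L\<^sub>g, real K, \<rho>, inverse \<rho>)
             * ((1 + inverse \<sigma>) * sqrt (V + L\<^sub>f\<^sup>2 + 1) + inverse \<sigma>) \<and>
        (c \<le> max (sqrt V) L\<^sub>f \<longrightarrow>
          regret f x xs T
            \<le> P' (R, H, F, G, L\<^sub>g, real K, \<rho>, inverse \<rho>, inverse \<sigma>) * max (sqrt V) L\<^sub>f)))"
proof -
  define P :: "real \<times> real \<times> real \<times> real \<times> real \<times> real \<times> real \<times> real \<Rightarrow> real" where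
    "P p = regret_const (fst p) (fst (snd p)) (fst (snd (snd p))) (fst (snd (snd (snd p))))
      (fst (snd (snd (snd (snd p))))) (fst (snd (snd (snd (snd (snd p))))))
      (snd (snd (snd (snd (snd (snd (snd p)))))))" for p
  define P' :: "real \<Rightarrow> real \<times> real \<times> real \<times> real \<times> real \<times> real \<times> real \<times> real \<times> real \<Rightarrow> real" where
    "P' c p = regret_const (fst p) (fst (snd p)) (fst (snd (snd p))) (fst (snd (snd (snd p))))
      (fst (snd (snd (snd (snd p))))) (fst (snd (snd (snd (snd (snd p))))))
      (fst (snd (snd (snd (snd (snd (snd (snd p))))))))
      * ((1 + snd (snd (snd (snd (snd (snd (snd (snd p)))))))) * (2 + 1 / c))" for c p
  note linear_intros = bounded_linear_fst_comp bounded_linear_snd_comp bounded_linear_ident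
  have P: "real_polynomial_function P"
    unfolding P_def[abs_def]
    by (intro real_polynomial_function_regret_const real_polynomial_function.intros(1) linear_intros)
  have P': "real_polynomial_function (P' c)" for c
    unfolding P'_def[abs_def]
    by (intro real_polynomial_function.intros(4) real_polynomial_function_regret_const
        real_polynomial_function.intros(1-3) linear_intros)
  have bounds: "regret f x xs T
      \<le> P (R, H, F, G, L\<^sub>g, real K, \<rho>, inverse \<rho>)
         * ((1 + inverse \<sigma>) * sqrt (V + L\<^sub>f\<^sup>2 + 1) + inverse \<sigma>) \<and>
    (c \<le> max (sqrt V) L\<^sub>f \<longrightarrow>
      regret f x xs T
        \<le> P' c (R, H, F, G, L\<^sub>g, real K, \<rho>, inverse \<rho>, inverse \<sigma>) * max (sqrt V) L\<^sub>f)"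
    if c: "0 < c"
      and oco: "constrained_oco d N X0 f df K g dg F L\<^sub>f G Hk L\<^sub>g"
      and H: "H = (\<Sum>k=1..K. Hk k)"
      and slater: "slater X0 K g \<sigma>"
      and dgf: "distance_generating d N X0 \<omega> d\<omega> \<rho>"
      and R: "\<forall>u\<in>X0. \<forall>v\<in>X0. bregman \<omega> d\<omega> u v \<le> R\<^sup>2"
      and T: "1 \<le> T"
      and V: "V = grad_variation d N X0 df T"
      and \<eta>: "\<eta> = (V + L\<^sub>f\<^sup>2 + 1) powr (- 1 / 2)"
      and \<gamma>: "\<gamma> = (V + L\<^sub>f\<^sup>2 + 1) powr (1 / 4)"
      and \<xi>: "\<forall>t\<in>{1..T}. \<xi> t = \<gamma> * L\<^sub>g * dual_l1 K (Q t) + \<gamma>\<^sup>2 * (L\<^sub>g * G + H\<^sup>2)"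
      and \<alpha>0: "\<alpha> 0 = 0"
      and \<alpha>: "\<forall>t\<in>{1..T}. \<alpha> t =
        max (2 * inverse \<rho> * (\<gamma>\<^sup>2 * L\<^sub>g * G + \<eta> * L\<^sub>f\<^sup>2 + inverse \<eta> + \<xi> t)) (\<alpha> (t - 1))"
      and run: "mirror_prox_run X0 df K g dg \<omega> d\<omega> \<gamma> \<alpha> T x xt Q"
      and xs: "is_arg_min (\<lambda>u. \<Sum>t=1..T. f t u) (\<lambda>u. u \<in> feasible_set X0 K g) xs"
    for c d N X0 f df K g dg F L\<^sub>f G Hk L\<^sub>g \<omega> d\<omega> \<rho> R \<sigma> T H V \<eta> \<gamma> \<xi> \<alpha> x xt Q xs
  proof -
    interpret constrained_oco d N X0 f df K g dg F L\<^sub>f G Hk L\<^sub>g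
      by (rule oco)
    interpret distance_generating d N X0 \<omega> d\<omega> \<rho>
      by (rule dgf)
    define w where "w = sqrt (V + L\<^sub>f\<^sup>2 + 1)"
    have "X0 \<noteq> {}"
      using run by (auto simp: mirror_prox_run_def)
    then have V0: "0 \<le> V"
      unfolding V by (rule grad_variation_nonneg)
    then have W: "1 \<le> V + L\<^sub>f\<^sup>2 + 1"
      by simp
    have \<gamma>2: "\<gamma>\<^sup>2 = w" and \<eta>w: "\<eta> = inverse w"
      unfolding \<gamma> \<eta> w_def by (rule powr_tuning[OF W])+
    have w1: "1 \<le> w"
      using W by (simp add: w_def)
    interpret tuned_mirror_prox d N X0 f df K g dg F L\<^sub>f G Hk L\<^sub>g \<omega> d\<omega> \<rho> H R \<gamma> \<eta> \<alpha> T x xt Q w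
    proof unfold_locales
      show "H = (\<Sum>k=1..K. Hk k)"
        by (rule H)
      show "bregman \<omega> d\<omega> u v \<le> R\<^sup>2" if "u \<in> X0" "v \<in> X0" for u v
        using R that by blast
      show "0 < \<gamma>"
        using W by (simp add: \<gamma>)
      show "0 < \<eta>" "\<eta> = inverse w" "1 \<le> w" "\<gamma>\<^sup>2 = w"
        using w1 \<eta>w \<gamma>2 by auto
      show "mirror_prox_run X0 df K g dg \<omega> d\<omega> \<gamma> \<alpha> T x xt Q" "\<alpha> 0 = 0"
        by (rule run \<alpha>0)+
      show "\<alpha> t = max (2 * inverse \<rho> * (\<gamma>\<^sup>2 * L\<^sub>g * G + \<eta> * L\<^sub>f\<^sup>2 + inverse \<eta>
          + (\<gamma> * L\<^sub>g * dual_l1 K (Q t) + \<gamma>\<^sup>2 * (L\<^sub>g * G + H\<^sup>2)))) (\<alpha> (t - 1))"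
        if "t \<in> {1..T}" for t
        using \<alpha> \<xi> that by metis
      show "grad_variation d N X0 df T + L\<^sub>f\<^sup>2 \<le> w\<^sup>2"
        using W by (simp add: w_def V[symmetric])
    qed
    let ?P = "regret_const R H F G L\<^sub>g (real K) (inverse \<rho>)"
    have "xs \<in> feasible_set X0 K g"
      using xs by (simp add: is_arg_min_def)
    then have reg: "regret f x xs T \<le> ?P * ((1 + inverse \<sigma>) * w)" and P0: "0 \<le> ?P"
      using regret_bound[OF slater T] by auto
    have \<sigma>: "0 < inverse \<sigma>"
      using slater by (simp add: slater_def)
    have "?P * ((1 + inverse \<sigma>) * w) \<le> ?P * ((1 + inverse \<sigma>) * w + inverse \<sigma>)"
      using \<sigma> by (intro mult_left_mono P0) auto
    then have first: "regret f x xs T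
      \<le> P (R, H, F, G, L\<^sub>g, real K, \<rho>, inverse \<rho>)
         * ((1 + inverse \<sigma>) * sqrt (V + L\<^sub>f\<^sup>2 + 1) + inverse \<sigma>)"
      using reg by (simp add: P_def w_def)
    have "regret f x xs T
        \<le> P' c (R, H, F, G, L\<^sub>g, real K, \<rho>, inverse \<rho>, inverse \<sigma>) * max (sqrt V) L\<^sub>f"
      if "c \<le> max (sqrt V) L\<^sub>f"
    proof -
      define m where "m = max (sqrt V) L\<^sub>f"
      have m: "c \<le> m" "0 \<le> m"
        using that c by (auto simp: m_def)
      have "(sqrt V)\<^sup>2 \<le> m\<^sup>2"
        unfolding m_def using V0 by (intro power_mono) auto
      moreover have "L\<^sub>f\<^sup>2 \<le> m\<^sup>2"
        unfolding m_def using Lf_nonneg by (intro power_mono) auto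
      ultimately have "V + L\<^sub>f\<^sup>2 + 1 \<le> 2 * m\<^sup>2 + 1"
        using V0 by simp
      also have "\<dots> \<le> (2 * m + 1)\<^sup>2"
        using m by (simp add: power2_eq_square algebra_simps)
      \<comment> \<open>The additive \<open>1\<close> is absorbed by \<open>1 \<le> m / c\<close>, whence the factor \<open>2 + 1 / c\<close> in \<open>P'\<close>.\<close>
      also have "\<dots> \<le> (2 * m + m / c)\<^sup>2"
        using m c by (intro power_mono) (auto simp: field_simps)
      finally have "w \<le> 2 * m + m / c"
        unfolding w_def using m c by (intro real_le_lsqrt) auto
      then have "?P * ((1 + inverse \<sigma>) * w) \<le> ?P * ((1 + inverse \<sigma>) * (2 * m + m / c))"
        using \<sigma> by (intro mult_left_mono P0) auto
      also have "\<dots> = P' c (R, H, F, G, L\<^sub>g, real K, \<rho>, inverse \<rho>, inverse \<sigma>) * m"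
        by (simp add: P'_def distrib_left distrib_right mult_ac)
      finally show ?thesis
        using reg by (simp add: m_def)
    qed
    with first show ?thesis
      by blast
  qed
  show ?thesis
  proof (intro exI[of _ P] conjI allI impI)
    fix c :: real assume c: "0 < c"
    show "\<exists>P'. real_polynomial_function P' \<and>
      (\<forall>d N X0 f df K g dg F L\<^sub>f G Hk L\<^sub>g \<omega> d\<omega> \<rho> R \<sigma> T H V \<eta> \<gamma> \<xi> \<alpha> x xt Q xs.
        constrained_oco d N X0 f df K g dg F L\<^sub>f G Hk L\<^sub>g \<longrightarrow>
        H = (\<Sum>k=1..K. Hk k) \<longrightarrow>
        slater X0 K g \<sigma> \<longrightarrow>
        distance_generating d N X0 \<omega> d\<omega> \<rho> \<longrightarrow>
        0 < R \<longrightarrow> (\<forall>u\<in>X0. \<forall>v\<in>X0. bregman \<omega> d\<omega> u v \<le> R\<^sup>2) \<longrightarrow>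
        1 \<le> T \<longrightarrow>
        V = grad_variation d N X0 df T \<longrightarrow>
        \<eta> = (V + L\<^sub>f\<^sup>2 + 1) powr (- 1 / 2) \<longrightarrow>
        \<gamma> = (V + L\<^sub>f\<^sup>2 + 1) powr (1 / 4) \<longrightarrow>
        (\<forall>t\<in>{1..T}. \<xi> t = \<gamma> * L\<^sub>g * dual_l1 K (Q t) + \<gamma>\<^sup>2 * (L\<^sub>g * G + H\<^sup>2)) \<longrightarrow>
        \<alpha> 0 = 0 \<longrightarrow>
        (\<forall>t\<in>{1..T}. \<alpha> t =
           max (2 * inverse \<rho> * (\<gamma>\<^sup>2 * L\<^sub>g * G + \<eta> * L\<^sub>f\<^sup>2 + inverse \<eta> + \<xi> t)) (\<alpha> (t - 1))) \<longrightarrow>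
        mirror_prox_run X0 df K g dg \<omega> d\<omega> \<gamma> \<alpha> T x xt Q \<longrightarrow>
        is_arg_min (\<lambda>u. \<Sum>t=1..T. f t u) (\<lambda>u. u \<in> feasible_set X0 K g) xs \<longrightarrow>
        regret f x xs T
          \<le> P (R, H, F, G, L\<^sub>g, real K, \<rho>, inverse \<rho>)
             * ((1 + inverse \<sigma>) * sqrt (V + L\<^sub>f\<^sup>2 + 1) + inverse \<sigma>) \<and>
        (c \<le> max (sqrt V) L\<^sub>f \<longrightarrow>
          regret f x xs T
            \<le> P' (R, H, F, G, L\<^sub>g, real K, \<rho>, inverse \<rho>, inverse \<sigma>) * max (sqrt V) L\<^sub>f))"
      by (intro exI[of _ "P' c"] conjI[OF P'] allI impI) (rule bounds[OF c])
  qed (rule P)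
qed

end
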